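(* Let $p\in[0,1]$ and let $\psi:\mathcal H\to\mathbb R\cup\{+\infty\}$ be a convex, coercive and lower semicontinuous function such that $M(p)\cap\operatorname{dom}\psi\neq\emptyset$. Then, with $(P)$, $(P_\lambda)$ and their optimal values $v(P)$, $v(P_\lambda)$ as defined in the context: a) $v(P),v(P_\lambda)\in\mathbb R$ for all $\lambda>0$, and $v(P_\lambda)\to v(P)$ as $\lambda\to0^+$. b) Let $\lambda_k\to0^+$ and let $(x_{\lambda_k})$ be any sequence of optimal solutions of $(P_{\lambda_k})$. If $x_{\lambda_k}\rightharpoonup x_0$ (weakly), then $x_0$ is an optimal solution of $(P)$, provided that the function $h$ is sequentially weakly continuous. If, furthermore, $\operatorname{dom}\psi=\mathcal H$ and the Legendre–Fenchel conjugate $\psi^*$ is Fréchet differentiable on $\operatorname{dom}\partial\psi^*$, then $x_{\lambda_k}\to x_0$ in norm.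
   Context: $\mathcal H$ is a separable real Hilbert space; $\mathcal Y$ is a real Banach space with dual $\mathcal Y^*$; $\mathcal H\times\mathbb R^m$ carries the product inner product. $\mathcal K\subset\mathcal Y$ is a nonempty convex cone and $\mathcal K^+:=\{v^*\in\mathcal Y^*:\langle v^*,v\rangle\ge0\ \forall v\in\mathcal K\}$. $\mathcal C\subset\mathcal Y^*$ is a weak$^*$-compact convex set with $\operatorname{cl}^{w^*}\operatorname{cone}\mathcal C=\mathcal K^+$, where $\operatorname{cone}\mathcal C=\{tc:t\ge0,c\in\mathcal C\}$. $\Phi:\mathcal H\times\mathbb R^m\to\mathcal Y$ is continuous, and $h:\mathcal H\to\mathbb R$ is a continuously differentiable convex function such that for every $v^*\in\mathcal C$ the function $(x,z)\mapsto\langle v^*,\Phi(x,z)\rangle+h(x)$ is convex on $\mathcal H\times\mathbb R^m$. Put $S^h_\Phi(x,z):=\sup\{\langle v^*,\Phi(x,z)\rangle+h(x): v^*\in\mathcal C\}$. Moreau envelope: for a proper convex lower semicontinuous $f$ on a Hilbert space $X$ and $\lambda>0$, $\mathrm e_\lambda f(u):=\inf_{w\in X}\left(f(w)+\frac1{2\lambda}\|u-w\|^2\right)$. $\xi:\Omega\to\mathbb R^m$ is a random vector having a density with respect to Lebesgue measure. $\varphi(x):=\mathbb P(\Phi(x,\xi)\in-\mathcal K)$ and $\varphi_\lambda(x):=\mathbb P(\mathrm e_\lambda S^h_\Phi(x,\xi)\le h(x))$, the envelope being taken on $\mathcal H\times\mathbb R^m$. $M(p):=\{x\in\mathcal H:\varphi(x)\ge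 p\}$ and $M_\lambda(p):=\{x\in\mathcal H:\varphi_\lambda(x)\ge p\}$. $(P)$ is the problem of minimizing $\psi(x)$ over $x\in M(p)$; $(P_\lambda)$ is the problem of minimizing $\mathrm e_\lambda\psi(x)$ (envelope on $\mathcal H$) over $x\in M_\lambda(p)$; $v(P)$ and $v(P_\lambda)$ are the infima. $\psi$ is coercive if $\{x\in\mathcal H:\psi(x)\le\alpha\}$ is bounded for all $\alpha\in\mathbb R$. $\operatorname{dom}\psi=\{x:\psi(x)<+\infty\}$, $\psi^*(z)=\sup_{y\in\mathcal H}\{\langle z,y\rangle-\psi(y)\}$, $\partial\psi^*$ is the convex subdifferential and $\operatorname{dom}\partial\psi^*=\{z:\partial\psi^*(z)\ne\emptyset\}$.
   Formalization: The cone K is assumed closed, and in a) the convergence v(P_λ) → v(P) is claimed only when h is sequentially weakly continuous (the proviso stated in b)); without either assumption the claim is false. *)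

theory Defs
  imports "HOL-Analysis.Analysis" "HOL-Probability.Probability"
begin

text \<open>
  Extended real valued functions have codomain \<^typ>\<open>ereal\<close>; \<open>0 * \<infinity> = 0\<close> holds there, and
  infima and suprema are taken in the complete lattice \<^typ>\<open>ereal\<close>.
\<close>

text \<open>
  For functionals, the strong operator topology of the library is the topology of pointwise
  convergence, i.e. the weak* topology.
\<close>
abbreviation weak_star_topology :: "('y::real_normed_vector \<Rightarrow>\<^sub>L real) topology" where
  "weak_star_topology \<equiv> strong_operator_topology"

definition dual_cone :: "'y::real_normed_vector set \<Rightarrow> ('y \<Rightarrow>\<^sub>L real) set" where
  "dual_cone K = {v. \<forall>y\<in>K. blinfun_apply v y \<ge> 0}"

definition cone_of :: "'a::real_vector set \<Rightarrow> 'a set" where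
  "cone_of C = {t *\<^sub>R c |t c. t \<ge> 0 \<and> c \<in> C}"

definition weakly_tendsto :: "(nat \<Rightarrow> 'h::real_inner) \<Rightarrow> 'h \<Rightarrow> bool" where
  "weakly_tendsto x l \<longleftrightarrow> (\<forall>y. (\<lambda>n. x n \<bullet> y) \<longlonglongrightarrow> l \<bullet> y)"

definition seq_weakly_continuous :: "('h::real_inner \<Rightarrow> real) \<Rightarrow> bool" where
  "seq_weakly_continuous h \<longleftrightarrow> (\<forall>x l. weakly_tendsto x l \<longrightarrow> (\<lambda>n. h (x n)) \<longlonglongrightarrow> h l)"

definition continuously_differentiable :: "('h::real_normed_vector \<Rightarrow> real) \<Rightarrow> bool" where
  "continuously_differentiable h \<longleftrightarrow>
     (\<exists>h'. (\<forall>x. (h has_derivative blinfun_apply (h' x)) (at x)) \<and> continuous_on UNIV h')"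

definition convex_ereal :: "('h::real_vector \<Rightarrow> ereal) \<Rightarrow> bool" where
  "convex_ereal f \<longleftrightarrow> (\<forall>x y. \<forall>t\<in>{0..1::real}.
     f ((1 - t) *\<^sub>R x + t *\<^sub>R y) \<le> ereal (1 - t) * f x + ereal t * f y)"

definition lsc :: "('h::topological_space \<Rightarrow> ereal) \<Rightarrow> bool" where
  "lsc f \<longleftrightarrow> (\<forall>x. f x \<le> Liminf (at x) f)"

definition coercive :: "('h::metric_space \<Rightarrow> ereal) \<Rightarrow> bool" where
  "coercive f \<longleftrightarrow> (\<forall>\<alpha>::real. bounded {x. f x \<le> ereal \<alpha>})"

definition edom :: "('h \<Rightarrow> ereal) \<Rightarrow> 'h set" where
  "edom f = {x. f x < \<infinity>}"

definition conjugate :: "('h::real_inner \<Rightarrow> ereal) \<Rightarrow> 'h \<Rightarrow> ereal" where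
  "conjugate f z = (SUP y. ereal (z \<bullet> y) - f y)"

text \<open>As usual, the subdifferential is empty at points where the function is not finite.\<close>
definition subdifferential :: "('h::real_inner \<Rightarrow> ereal) \<Rightarrow> 'h \<Rightarrow> 'h set" where
  "subdifferential f z = {x. \<bar>f z\<bar> \<noteq> \<infinity> \<and> (\<forall>u. f u \<ge> f z + ereal (x \<bullet> (u - z)))}"

definition dom_subdifferential :: "('h::real_inner \<Rightarrow> ereal) \<Rightarrow> 'h set" where
  "dom_subdifferential f = {z. subdifferential f z \<noteq> {}}"

text \<open>
  Frechet differentiability at a point requires finiteness in a neighbourhood of it; this makes
  \<^const>\<open>real_of_ereal\<close> harmless.
\<close>
definition frechet_differentiable_at :: "('h::real_normed_vector \<Rightarrow> ereal) \<Rightarrow> 'h \<Rightarrow> bool" where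
  "frechet_differentiable_at f z \<longleftrightarrow>
     (\<forall>\<^sub>F u in nhds z. \<bar>f u\<bar> \<noteq> \<infinity>) \<and> (\<lambda>u. real_of_ereal (f u)) differentiable (at z)"

definition moreau :: "real \<Rightarrow> ('h::real_normed_vector \<Rightarrow> ereal) \<Rightarrow> 'h \<Rightarrow> ereal" where
  "moreau lam f u = (INF w. f w + ereal ((norm (u - w))\<^sup>2 / (2 * lam)))"

definition sup_fun :: "('y::real_normed_vector \<Rightarrow>\<^sub>L real) set \<Rightarrow> ('h \<times> 'z \<Rightarrow> 'y) \<Rightarrow> ('h \<Rightarrow> real) \<Rightarrow>
    'h \<times> 'z \<Rightarrow> ereal" where
  "sup_fun C \<Phi> h = (\<lambda>(x, z). SUP v\<in>C. ereal (blinfun_apply v (\<Phi> (x, z)) + h x))"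

definition prob_fun :: "'w measure \<Rightarrow> ('w \<Rightarrow> 'z) \<Rightarrow> 'y::real_normed_vector set \<Rightarrow>
    ('h \<times> 'z \<Rightarrow> 'y) \<Rightarrow> 'h \<Rightarrow> real" where
  "prob_fun \<Omega> \<xi> K \<Phi> x = measure \<Omega> {\<omega> \<in> space \<Omega>. \<Phi> (x, \<xi> \<omega>) \<in> uminus ` K}"

text \<open>The envelope is taken jointly in both variables, w.r.t. the product norm.\<close>
definition prob_fun_env :: "'w measure \<Rightarrow> ('w \<Rightarrow> 'z::real_normed_vector) \<Rightarrow>
    ('y::real_normed_vector \<Rightarrow>\<^sub>L real) set \<Rightarrow> ('h::real_normed_vector \<times> 'z \<Rightarrow> 'y) \<Rightarrow> ('h \<Rightarrow> real) \<Rightarrow>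
    real \<Rightarrow> 'h \<Rightarrow> real" where
  "prob_fun_env \<Omega> \<xi> C \<Phi> h lam x =
     measure \<Omega> {\<omega> \<in> space \<Omega>. moreau lam (sup_fun C \<Phi> h) (x, \<xi> \<omega>) \<le> ereal (h x)}"

definition feasible :: "('h \<Rightarrow> real) \<Rightarrow> real \<Rightarrow> 'h set" where
  "feasible \<phi> p = {x. \<phi> x \<ge> p}"

definition opt_value :: "('h \<Rightarrow> ereal) \<Rightarrow> 'h set \<Rightarrow> ereal" where
  "opt_value f S = (INF x\<in>S. f x)"

definition optimal_solution :: "('h \<Rightarrow> ereal) \<Rightarrow> 'h set \<Rightarrow> 'h \<Rightarrow> bool" where
  "optimal_solution f S x \<longleftrightarrow> is_arg_min f (\<lambda>x. x \<in> S) x"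

end

theory Submission
  imports Defs "HOL-Library.Diagonal_Subsequence"
begin

text \<open>
  A convex lower semicontinuous \<open>f\<close> on a Hilbert space is the supremum of its affine minorants, and
  the Moreau envelope of parameter \<open>lam\<close> of an affine function of slope \<open>g\<close> is that function minus
  \<open>lam / 2 * (g \<bullet> g)\<close>. Hence the envelopes satisfy a joint lower semicontinuity: if
  \<open>lams k\<close> tends to \<open>0\<close> and \<open>x k\<close> tends weakly to \<open>x0\<close>, then \<open>f x0\<close> is at most the lower limit
  of \<open>moreau (lams k) f (x k)\<close>. Applied to the supremum function for each fixed value of the random
  vector (and to the upper limit of the corresponding events) this shows that weak limits of points
  feasible for the regularised problems are feasible for the original one; applied to the objective
  it gives convergence of values and optimality of weak limits. Since envelopes lie below the
  functions, the other inequalities are immediate. Strong convergence comes from the duality between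
  Frechet differentiability of the conjugate and strong minimality.
\<close>

subsection \<open>Separation from closed convex cones\<close>

text \<open>Homogeneity is asked for only as an inequality with positive factors, which is easy to
  check for infima; using it for \<open>1 / t\<close> as well recovers equality.\<close>

definition sublinear :: "('a::real_vector \<Rightarrow> real) \<Rightarrow> bool" where
  "sublinear q \<longleftrightarrow> (\<forall>x y. q (x + y) \<le> q x + q y) \<and> (\<forall>t>0. \<forall>x. q (t *\<^sub>R x) \<le> t * q x)"

lemma sublinear_zero: "q 0 = 0" if "sublinear q"
proof -
  have "q (0 + 0) \<le> q 0 + q 0" "q ((1/2::real) *\<^sub>R 0) \<le> 1/2 * q 0"
    using that unfolding sublinear_def by (blast, metis half_gt_zero zero_less_one)
  then show ?thesis by simp
qed

lemma sublinear_neg_le: "- q (- x) \<le> q x" if "sublinear q"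
proof -
  have "q (x + - x) \<le> q x + q (- x)"
    using that unfolding sublinear_def by blast
  then show ?thesis
    using sublinear_zero[OF that] by simp
qed

lemma sublinear_odd_imp_linear:
  assumes q: "sublinear q" and odd: "\<And>x. q (- x) = - q x"
  shows "linear q"
proof (rule linearI)
  have le: "q (x + y) \<le> q x + q y" for x y
    using q unfolding sublinear_def by blast
  fix x y show "q (x + y) = q x + q y"
    using le[of x y] le[of "- x" "- y"] odd[of x] odd[of y] odd[of "x + y"] by simp
next
  have pos: "q (t *\<^sub>R x) = t * q x" if "t > 0" for t x
  proof (rule antisym)
    show "q (t *\<^sub>R x) \<le> t * q x"
      using q that unfolding sublinear_def by blast
    have "q ((1/t) *\<^sub>R (t *\<^sub>R x)) \<le> (1/t) * q (t *\<^sub>R x)"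
      using q that unfolding sublinear_def by (meson zero_less_divide_1_iff)
    then show "t * q x \<le> q (t *\<^sub>R x)"
      using that by (simp add: field_simps)
  qed
  fix t x show "q (t *\<^sub>R x) = t *\<^sub>R q x"
  proof (cases t "0::real" rule: linorder_cases)
    case less
    then show ?thesis using pos[of "-t" x] odd[of "t *\<^sub>R x"] by simp
  next
    case equal
    then show ?thesis using sublinear_zero[OF q] by simp
  next
    case greater
    then show ?thesis using pos by simp
  qed
qed

text \<open>Lowers \<open>q\<close> until it is odd along \<open>a\<close>: in the infimum of
  \<open>q (x + t *\<^sub>R a) - t * q a\<close> over \<open>t \<ge> 0\<close>, the choice
  \<open>t = 0\<close> gives \<open>r x \<le> q x\<close> and \<open>t = 1\<close> at
  \<open>- a\<close> gives the last bound. The value \<open>- q (- x)\<close> keeps the infimum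
  finite.\<close>

lemma sublinear_reduce:
  fixes q :: "'a::real_vector \<Rightarrow> real"
  assumes q: "sublinear q"
  obtains r where "sublinear r" "\<And>x. r x \<le> q x" "r (- a) \<le> - q a"
proof
  define r where "r x = (INF t\<in>{0::real..}. q (x + t *\<^sub>R a) - t * q a)" for x
  have add: "q (x + y) \<le> q x + q y" for x y
    using q unfolding sublinear_def by blast
  have scale: "q (t *\<^sub>R x) \<le> t * q x" if "t > 0" for t x
    using q that unfolding sublinear_def by blast
  have scale': "t * q x \<le> q (t *\<^sub>R x)" if "t \<ge> 0" for t x
  proof (cases "t = 0")
    case False
    with that scale[of "1/t" "t *\<^sub>R x"] show ?thesis by (simp add: field_simps)
  qed (simp add: sublinear_zero[OF q])
  have bdd: "bdd_below ((\<lambda>t. q (x + t *\<^sub>R a) - t * q a) ` {0..})" for x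
  proof (rule bdd_belowI2[where m = "- q (- x)"])
    fix t :: real assume "t \<in> {0..}"
    then show "- q (- x) \<le> q (x + t *\<^sub>R a) - t * q a"
      using add[of "- x" "x + t *\<^sub>R a"] scale'[of t a] by simp
  qed
  have lower: "r x \<le> q (x + t *\<^sub>R a) - t * q a" if "t \<ge> 0" for x t
    unfolding r_def using that by (intro cINF_lower[OF bdd]) auto
  show "r x \<le> q x" for x
    using lower[of 0 x] by simp
  show "r (- a) \<le> - q a"
    using lower[of 1 "- a"] sublinear_zero[OF q] by simp
  show "sublinear r"
    unfolding sublinear_def
  proof (intro conjI allI impI)
    fix x y
    have sum: "r (x + y) \<le> (q (x + s *\<^sub>R a) - s * q a) + (q (y + t *\<^sub>R a) - t * q a)"
      if "s \<ge> 0" "t \<ge> 0" for s t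
      using lower[of "s + t" "x + y"] add[of "x + s *\<^sub>R a" "y + t *\<^sub>R a"] that
      by (simp add: algebra_simps)
    have "r (x + y) - (q (x + s *\<^sub>R a) - s * q a) \<le> r y" if "s \<ge> 0" for s
      unfolding r_def[of y] using sum[OF that] by (intro cINF_greatest) (auto simp: algebra_simps)
    then have "r (x + y) - r y \<le> r x"
      unfolding r_def[of x] by (intro cINF_greatest) (auto simp: algebra_simps)
    then show "r (x + y) \<le> r x + r y" by simp
  next
    fix t :: real and x :: 'a assume t: "t > 0"
    have "r (t *\<^sub>R x) / t \<le> q (x + s *\<^sub>R a) - s * q a" if "s \<ge> 0" for s
    proof -
      have "r (t *\<^sub>R x) \<le> q (t *\<^sub>R (x + s *\<^sub>R a)) - (t * s) * q a"
        using lower[of "t * s" "t *\<^sub>R x"] t that by (simp add: algebra_simps)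
      also have "\<dots> \<le> t * (q (x + s *\<^sub>R a) - s * q a)"
        using scale[OF t, of "x + s *\<^sub>R a"] by (simp add: algebra_simps)
      finally show ?thesis
        using t by (simp add: field_simps)
    qed
    then have "r (t *\<^sub>R x) / t \<le> r x"
      unfolding r_def[of x] by (intro cINF_greatest) auto
    then show "r (t *\<^sub>R x) \<le> t * r x"
      using t by (simp add: field_simps)
  qed
qed

text \<open>Provides lower bounds of chains for Zorn's lemma. The common bound \<open>q0\<close>
  keeps the infimum finite, as \<open>- q0 (- x) \<le> - q (- x) \<le> q x\<close>; the chain
  property lets one member replace two when subadditivity is proved.\<close>

lemma sublinear_chain_INF:
  fixes D :: "('a::real_vector \<Rightarrow> real) set"
  assumes ne: "D \<noteq> {}" and sub: "\<And>q. q \<in> D \<Longrightarrow> sublinear q"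
    and chain: "\<And>q q'. q \<in> D \<Longrightarrow> q' \<in> D \<Longrightarrow> q \<le> q' \<or> q' \<le> q"
    and le: "\<And>q. q \<in> D \<Longrightarrow> q \<le> q0"
  shows "sublinear (\<lambda>x. INF q\<in>D. q x)" "\<And>q x. q \<in> D \<Longrightarrow> (INF q\<in>D. q x) \<le> q x"
proof -
  define r where "r x = (INF q\<in>D. q x)" for x
  have bdd: "bdd_below ((\<lambda>q. q x) ` D)" for x
  proof (rule bdd_belowI2[where m = "- q0 (- x)"])
    fix q assume "q \<in> D"
    then show "- q0 (- x) \<le> q x"
      using le[of q] sublinear_neg_le[OF sub, of q x] unfolding le_fun_def
      by (metis neg_le_iff_le order_trans)
  qed
  then have lower: "r x \<le> q x" if "q \<in> D" for q x
    unfolding r_def using that by (intro cINF_lower)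
  then show "\<And>q x. q \<in> D \<Longrightarrow> (INF q\<in>D. q x) \<le> q x"
    unfolding r_def by blast
  have "sublinear r"
    unfolding sublinear_def
  proof (intro conjI allI impI)
    fix x y
    have sum: "r (x + y) \<le> q x + q' y" if D: "q \<in> D" "q' \<in> D" for q q'
    proof -
      obtain q'' where q'': "q'' \<in> D" "q'' \<le> q" "q'' \<le> q'"
        using chain[OF D] D by blast
      have "r (x + y) \<le> q'' (x + y)"
        by (rule lower[OF q''(1)])
      also have "\<dots> \<le> q'' x + q'' y"
        using sub[OF q''(1)] unfolding sublinear_def by blast
      also have "\<dots> \<le> q x + q' y"
        using q'' by (intro add_mono) (auto simp: le_fun_def)
      finally show ?thesis .
    qed
    have "r (x + y) - q x \<le> r y" if "q \<in> D" for q
      unfolding r_def[of y] using sum[OF that] by (intro cINF_greatest[OF ne]) (auto simp: algebra_simps)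
    then have "r (x + y) - r y \<le> r x"
      unfolding r_def[of x] by (intro cINF_greatest[OF ne]) (auto simp: algebra_simps)
    then show "r (x + y) \<le> r x + r y" by simp
  next
    fix t :: real and x :: 'a assume t: "t > 0"
    have "r (t *\<^sub>R x) / t \<le> q x" if "q \<in> D" for q
    proof -
      have "q (t *\<^sub>R x) \<le> t * q x"
        using sub[OF that] t unfolding sublinear_def by blast
      then show ?thesis
        using lower[OF that, of "t *\<^sub>R x"] t by (simp add: field_simps)
    qed
    then have "r (t *\<^sub>R x) / t \<le> r x"
      unfolding r_def[of x] by (intro cINF_greatest[OF ne]) auto
    then show "r (t *\<^sub>R x) \<le> t * r x"
      using t by (simp add: field_simps)
  qed
  then show "sublinear (\<lambda>x. INF q\<in>D. q x)"
    unfolding r_def .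
qed

text \<open>A minimal sublinear functional is odd by \<open>sublinear_reduce\<close>, hence linear.\<close>

lemma hahn_banach_sublinear:
  fixes q :: "'a::real_vector \<Rightarrow> real"
  assumes q: "sublinear q"
  obtains f where "linear f" "\<And>x. f x \<le> q x"
proof -
  let ?A = "{r. sublinear r \<and> r \<le> q}"
  \<comment> \<open>The order is reversed, so the maximal element of Zorn's lemma is a minimal
    sublinear functional below \<open>q\<close>.\<close>
  have "\<exists>m\<in>?A. \<forall>a\<in>?A. m \<ge> a \<longrightarrow> a = m"
  proof (rule predicate_Zorn[where P = "(\<ge>)"])
    show "partial_order_on ?A (relation_of (\<ge>) ?A)"
      by (rule partial_order_on_relation_ofI) auto
    fix D assume D: "D \<in> Chains (relation_of (\<ge>) ?A)"
    show "\<exists>u\<in>?A. \<forall>a\<in>D. a \<ge> u"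
    proof (cases "D = {}")
      case True
      then show ?thesis using q by auto
    next
      case False
      have sub: "\<And>r. r \<in> D \<Longrightarrow> sublinear r" and le: "\<And>r. r \<in> D \<Longrightarrow> r \<le> q"
        and chain: "\<And>r s. r \<in> D \<Longrightarrow> s \<in> D \<Longrightarrow> r \<le> s \<or> s \<le> r"
        using D unfolding Chains_def relation_of_def by blast+
      let ?r = "\<lambda>x. INF r\<in>D. r x"
      have inf: "sublinear ?r"
        by (rule sublinear_chain_INF(1)[OF False, where ?q0.0 = q]) (use sub chain le in blast)+
      have lower: "?r \<le> r" if "r \<in> D" for r
        unfolding le_fun_def
        by (intro allI sublinear_chain_INF(2)[OF False, where ?q0.0 = q]) (use that sub chain le in blast)+
      obtain r where "r \<in> D" using False by blast
      then have "?r \<in> ?A"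
        using inf order_trans[OF lower le] by blast
      then show ?thesis
        using lower by blast
    qed
  qed
  then obtain m where m: "sublinear m" "m \<le> q"
    and minimal: "\<And>a. sublinear a \<Longrightarrow> a \<le> q \<Longrightarrow> a \<le> m \<Longrightarrow> a = m"
    by blast
  have "m (- x) = - m x" for x
  proof -
    obtain r where r: "sublinear r" "\<And>y. r y \<le> m y" "r (- x) \<le> - m x"
      using sublinear_reduce[OF m(1)] by metis
    have "r \<le> m"
      using r(2) by (simp add: le_fun_def)
    then have "r = m"
      using minimal[OF r(1)] m(2) by (meson order_trans)
    then show ?thesis
      using r(3) sublinear_neg_le[OF m(1), of x] by simp
  qed
  with m show ?thesis
    by (intro that[of m]) (auto simp: le_fun_def intro: sublinear_odd_imp_linear)
qed

text \<open>\<open>q x\<close> is the distance from \<open>- x\<close> to \<open>K\<close>,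
  sublinear because \<open>K\<close> is a convex cone. A linear functional below it has norm at most
  one and is nonpositive on \<open>- K\<close>. Reducing \<open>q\<close> at \<open>- y\<close>
  first forces the value at \<open>y\<close> down to \<open>- q (- y)\<close> or less, which is
  negative since \<open>K\<close> is closed.\<close>

lemma separate_point_closed_cone:
  fixes K :: "'a::real_normed_vector set"
  assumes K: "K \<noteq> {}" "convex K" "cone K" "closed K" and y: "y \<notin> K"
  obtains v :: "'a \<Rightarrow>\<^sub>L real" where "\<And>k. k \<in> K \<Longrightarrow> blinfun_apply v k \<ge> 0" "blinfun_apply v y < 0"
proof -
  define q where "q x = (INF k\<in>K. norm (x + k))" for x
  have bdd: "bdd_below ((\<lambda>k. norm (x + k)) ` K)" for x
    by (rule bdd_belowI2[where m = 0]) simp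
  have lower: "q x \<le> norm (x + k)" if "k \<in> K" for x k
    unfolding q_def using that by (intro cINF_lower[OF bdd])
  have greatest: "c \<le> q x" if "\<And>k. k \<in> K \<Longrightarrow> c \<le> norm (x + k)" for x c
    unfolding q_def using that by (intro cINF_greatest[OF K(1)])
  have K_add: "k + l \<in> K" if "k \<in> K" "l \<in> K" for k l
    using K that convex_cone[of K] by blast
  have K_scale: "t *\<^sub>R k \<in> K" if "k \<in> K" "t \<ge> 0" for k t
    using K(3) that unfolding cone_def by blast
  have K_zero: "0 \<in> K"
    using K(1) K_scale[of _ 0] by auto
  have "sublinear q"
    unfolding sublinear_def
  proof (intro conjI allI impI)
    fix x z
    have sum: "q (x + z) \<le> norm (x + k) + norm (z + l)" if "k \<in> K" "l \<in> K" for k l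
      using lower[OF K_add[OF that], of "x + z"] norm_triangle_ineq[of "x + k" "z + l"]
      by (simp add: algebra_simps)
    have "q (x + z) - norm (x + k) \<le> q z" if "k \<in> K" for k
      using sum[OF that] by (intro greatest) (simp add: algebra_simps)
    then have "q (x + z) - q z \<le> q x"
      by (intro greatest) (simp add: algebra_simps)
    then show "q (x + z) \<le> q x + q z" by simp
  next
    fix t :: real and x :: 'a assume t: "t > 0"
    have "q (t *\<^sub>R x) / t \<le> norm (x + k)" if "k \<in> K" for k
    proof -
      have "q (t *\<^sub>R x) \<le> norm (t *\<^sub>R (x + k))"
        using lower[OF K_scale[OF that], of t "t *\<^sub>R x"] t by (simp add: scaleR_add_right)
      also have "\<dots> = t * norm (x + k)"
        using t by simp
      finally show ?thesis
        using t by (simp add: pos_divide_le_eq mult.commute)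
    qed
    then have "q (t *\<^sub>R x) / t \<le> q x"
      by (rule greatest)
    then show "q (t *\<^sub>R x) \<le> t * q x"
      using t by (simp add: field_simps)
  qed
  then obtain r where r: "sublinear r" "\<And>x. r x \<le> q x" "r (- (- y)) \<le> - q (- y)"
    using sublinear_reduce by metis
  then obtain f where f: "linear f" "\<And>x. f x \<le> r x"
    using hahn_banach_sublinear by metis
  have fq: "f x \<le> q x" for x
    using f(2) r(2) order_trans by blast
  have q_norm: "q x \<le> norm x" for x
    using lower[OF K_zero, of x] by simp
  have "bounded_linear f"
  proof (intro bounded_linear.intro bounded_linear_axioms.intro exI allI)
    show "linear f" by (rule f)
    fix x
    show "norm (f x) \<le> norm x * 1"
      using order_trans[OF fq q_norm, of x] order_trans[OF fq q_norm, of "- x"] linear_neg[OF f(1), of x]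
      by simp
  qed
  then have app: "blinfun_apply (Blinfun f) = f"
    by (rule bounded_linear_Blinfun_apply)
  show ?thesis
  proof (rule that[of "Blinfun f"])
    fix k assume k: "k \<in> K"
    have "f (- k) \<le> 0"
      using fq[of "- k"] lower[OF k, of "- k"] by simp
    then show "blinfun_apply (Blinfun f) k \<ge> 0"
      using linear_neg[OF f(1), of k] by (simp add: app)
  next
    have "open (- K)" using K(4) by (rule open_Compl)
    then obtain e where e: "e > 0" "ball y e \<subseteq> - K"
      using y openE by (metis ComplI)
    have "e \<le> q (- y)"
    proof (rule greatest)
      fix k assume "k \<in> K"
      then have "k \<notin> ball y e" using e(2) by blast
      then show "e \<le> norm (- y + k)"
        by (simp add: dist_norm norm_minus_commute)
    qed
    then show "blinfun_apply (Blinfun f) y < 0"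
      using f(2)[of y] r(3) e(1) by (simp add: app)
  qed
qed

text \<open>Evaluation at \<open>y\<close> is continuous in the weak star topology, so the
  functionals that are nonpositive at \<open>y\<close> form a closed set.\<close>

lemma blinfun_le_zero_closure:
  assumes "v \<in> weak_star_topology closure_of (cone_of C)"
    and "\<And>c. c \<in> C \<Longrightarrow> blinfun_apply c y \<le> 0"
  shows "blinfun_apply v y \<le> 0"
proof -
  have "closedin weak_star_topology {v \<in> topspace weak_star_topology. blinfun_apply v y \<in> {..0}}"
    by (rule closedin_continuous_map_preimage[OF strong_operator_topology_continuous_evaluation])
      (simp flip: closed_closedin)
  moreover have "cone_of C \<subseteq> {v \<in> topspace weak_star_topology. blinfun_apply v y \<in> {..0}}"
    using assms(2)
    by (auto simp: cone_of_def strong_operator_topology_topspace blinfun.scaleR_left mult_nonneg_nonpos)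
  ultimately show ?thesis
    using assms(1) closure_of_minimal by blast
qed

text \<open>A bipolar argument: if \<open>- y\<close> lay outside \<open>K\<close>, the separating
  functional would belong to \<open>dual_cone K\<close>, hence to the closure of the cone over
  \<open>C\<close>, where all values at \<open>y\<close> are nonpositive.\<close>

lemma mem_uminus_cone_iff:
  fixes K :: "'y::real_normed_vector set" and C :: "('y \<Rightarrow>\<^sub>L real) set"
  assumes K: "K \<noteq> {}" "convex K" "cone K" "closed K"
    and C: "weak_star_topology closure_of (cone_of C) = dual_cone K"
  shows "y \<in> uminus ` K \<longleftrightarrow> (\<forall>v\<in>C. blinfun_apply v y \<le> 0)"
proof
  assume "y \<in> uminus ` K"
  then obtain k where k: "k \<in> K" "y = - k" by blast
  show "\<forall>v\<in>C. blinfun_apply v y \<le> 0"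
  proof
    fix v assume "v \<in> C"
    then have "v \<in> cone_of C"
      unfolding cone_of_def by (auto intro!: exI[of _ 1] exI[of _ v])
    then have "v \<in> dual_cone K"
      using C closure_of_subset[of "cone_of C" weak_star_topology]
      by (auto simp: strong_operator_topology_topspace)
    then show "blinfun_apply v y \<le> 0"
      using k by (simp add: dual_cone_def blinfun.minus_right)
  qed
next
  assume neg: "\<forall>v\<in>C. blinfun_apply v y \<le> 0"
  show "y \<in> uminus ` K"
  proof (rule ccontr)
    assume "y \<notin> uminus ` K"
    then have "- y \<notin> K" by force
    then obtain v :: "'y \<Rightarrow>\<^sub>L real" where v: "\<And>k. k \<in> K \<Longrightarrow> blinfun_apply v k \<ge> 0" "blinfun_apply v (- y) < 0"
      using separate_point_closed_cone[OF K] by blast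
    then have "v \<in> weak_star_topology closure_of (cone_of C)"
      unfolding C dual_cone_def by blast
    from blinfun_le_zero_closure[OF this] neg v(2) show False
      by (simp add: blinfun.minus_right not_le[symmetric])
  qed
qed

subsection \<open>Convex lower semicontinuous functions and weak convergence\<close>

text \<open>The elements of nearly minimal norm form a Cauchy sequence by the parallelogram law.\<close>

lemma nested_closed_convex_Inter:
  fixes S :: "nat \<Rightarrow> 'a::{real_inner,complete_space} set"
  assumes closed: "\<And>n. closed (S n)" and convex: "\<And>n. convex (S n)" and ne: "\<And>n. S n \<noteq> {}"
    and dec: "decseq S" and bdd: "bounded (S 0)"
  obtains x where "\<And>n. x \<in> S n"
proof -
  define q where "q n = (INF x\<in>S n. (norm x)\<^sup>2)" for n
  have below: "bdd_below ((\<lambda>x. (norm x)\<^sup>2) ` A)" for A :: "'a set"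
    by (rule bdd_belowI2[where m = 0]) simp
  have q_le: "q n \<le> (norm x)\<^sup>2" if "x \<in> S n" for n x
    unfolding q_def using that by (intro cINF_lower[OF below])
  have S_mono: "S m \<subseteq> S n" if "n \<le> m" for n m
    using dec that by (auto simp: decseq_def)
  have "incseq q"
    unfolding incseq_def q_def using S_mono by (auto intro!: cINF_superset_mono[OF ne below])
  moreover obtain B where B: "\<And>x. x \<in> S 0 \<Longrightarrow> norm x \<le> B"
    using bdd unfolding bounded_iff by blast
  have "q n \<le> B\<^sup>2" for n
  proof -
    obtain x where x: "x \<in> S n" using ne by blast
    then have "norm x \<le> B" using B S_mono[of 0 n] by auto
    then have "(norm x)\<^sup>2 \<le> B\<^sup>2" by (intro power_mono) auto
    with q_le[OF x] show ?thesis by simp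
  qed
  ultimately have "convergent q"
    by (metis incseq_convergent convergentI)
  then have cq: "Cauchy q" by (rule convergent_Cauchy)
  have "\<exists>x. x \<in> S n \<and> (norm x)\<^sup>2 < q n + 1 / Suc n" for n
  proof -
    have "q n < q n + 1 / Suc n" by simp
    then show ?thesis
      unfolding q_def[of n] using cINF_less_iff[OF ne[of n] below[of "S n"]] by blast
  qed
  then obtain x where x: "\<And>n. x n \<in> S n" "\<And>n. (norm (x n))\<^sup>2 < q n + 1 / Suc n"
    by metis
  \<comment> \<open>The midpoint of \<open>x n\<close> and \<open>x m\<close> lies in
    \<open>S n\<close>, so its squared norm is at least \<open>q n\<close>; the parallelogram law
    turns this into a bound on the difference.\<close>
  have key: "(norm (x n - x m))\<^sup>2 \<le> 2 * (q m - q n) + 4 / Suc n" if "n \<le> m" for n m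
  proof -
    have "(1/2) *\<^sub>R x n + (1/2) *\<^sub>R x m \<in> S n"
      using x(1) S_mono[OF that] by (intro convexD[OF convex]) auto
    then have "4 * q n \<le> 4 * (norm ((1/2) *\<^sub>R x n + (1/2) *\<^sub>R x m))\<^sup>2"
      using q_le by simp
    also have "\<dots> = 2 * (norm (x n))\<^sup>2 + 2 * (norm (x m))\<^sup>2 - (norm (x n - x m))\<^sup>2"
      unfolding power2_norm_eq_inner by (simp add: algebra_simps inner_commute)
    also have "\<dots> \<le> 2 * (q n + 1 / Suc n) + 2 * (q m + 1 / Suc m) - (norm (x n - x m))\<^sup>2"
      using x(2)[of n] x(2)[of m] by simp
    also have "\<dots> \<le> 2 * (q n + 1 / Suc n) + 2 * (q m + 1 / Suc n) - (norm (x n - x m))\<^sup>2"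
      using frac_le[of 1 1 "Suc n" "Suc m"] that by simp
    finally show ?thesis by simp
  qed
  have "Cauchy x"
  proof (rule CauchyI')
    fix e :: real assume e: "e > 0"
    then obtain N where N: "\<And>m n. m \<ge> N \<Longrightarrow> n \<ge> N \<Longrightarrow> dist (q m) (q n) < e\<^sup>2 / 8"
      using cq unfolding Cauchy_def by (metis zero_less_power zero_less_divide_iff zero_less_numeral)
    have "e\<^sup>2 / 8 > 0" using e by simp
    then obtain N' where N': "1 / Suc N' < e\<^sup>2 / 8"
      using nat_approx_posE by blast
    show "\<exists>M. \<forall>m\<ge>M. \<forall>n>m. dist (x m) (x n) < e"
    proof (intro exI[of _ "max N N'"] allI impI)
      fix m n assume mn: "m \<ge> max N N'" "n > m"
      have "1 / Suc m \<le> 1 / Suc N'"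
        using mn by (intro frac_le) auto
      moreover have "q n - q m < e\<^sup>2 / 8"
        using N[of n m] mn unfolding dist_real_def by linarith
      ultimately have "2 * (q n - q m) + 4 * (1 / Suc m) < 2 * (e\<^sup>2 / 8) + 4 * (e\<^sup>2 / 8)"
        using N' by (intro add_strict_mono) auto
      also have "\<dots> < e\<^sup>2"
        using e by simp
      finally have "(norm (x m - x n))\<^sup>2 < e\<^sup>2"
        using key[OF less_imp_le[OF mn(2)]] by simp
      then show "dist (x m) (x n) < e"
        using e by (simp add: dist_norm power2_less_imp_less)
    qed
  qed
  then obtain l where l: "x \<longlonglongrightarrow> l"
    using Cauchy_convergent_iff convergentD by blast
  show ?thesis
  proof (rule that)
    fix n
    have "x (k + n) \<in> S n" for k
      using x(1)[of "k + n"] S_mono[of n "k + n"] by auto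
    then show "l \<in> S n"
      by (rule closed_sequentially[OF closed _ LIMSEQ_ignore_initial_segment[OF l]])
  qed
qed

text \<open>The parts of \<open>S\<close> within distance \<open>d + 1 / Suc n\<close> of
  \<open>a\<close> are nested, so they share a point, and it attains the distance \<open>d\<close>.
  The inequality is the first-order condition for a nearest point.\<close>

lemma closed_convex_projection:
  fixes S :: "'a::{real_inner,complete_space} set"
  assumes S: "closed S" "convex S" "S \<noteq> {}"
  obtains w where "w \<in> S" "\<And>u. u \<in> S \<Longrightarrow> (a - w) \<bullet> (u - w) \<le> 0"
proof -
  define d where "d = infdist a S"
  define T where "T n = S \<inter> cball a (d + 1 / Suc n)" for n
  obtain w where w: "\<And>n. w \<in> T n"
  proof (rule nested_closed_convex_Inter)
    show "closed (T n)" "convex (T n)" for n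
      using S unfolding T_def by (auto intro: convex_Int)
    show "T n \<noteq> {}" for n
    proof
      assume "T n = {}"
      then have "d + 1 / Suc n \<le> dist a u" if "u \<in> S" for u
        using that unfolding T_def by (force simp: disjoint_iff)
      then have "d + 1 / Suc n \<le> (INF u\<in>S. dist a u)"
        by (rule cINF_greatest[OF S(3)])
      then show False
        by (simp add: d_def infdist_notempty[OF S(3)])
    qed
    show "decseq T"
    proof (rule decseq_SucI)
      fix n
      have "1 / Suc (Suc n) \<le> 1 / Suc n" by (intro frac_le) auto
      then show "T (Suc n) \<subseteq> T n"
        unfolding T_def by auto
    qed
    show "bounded (T 0)"
      unfolding T_def by (intro bounded_Int) auto
  qed blast
  have "dist a w \<le> d"
  proof (rule field_le_epsilon)
    fix e :: real assume "e > 0"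
    then obtain n where "1 / Suc n < e" using nat_approx_posE by blast
    then show "dist a w \<le> d + e"
      using w[of n] unfolding T_def by auto
  qed
  then have closest: "\<forall>z\<in>S. dist a w \<le> dist a z"
    using infdist_le order_trans unfolding d_def by blast
  have "w \<in> S"
    using w[of 0] unfolding T_def by blast
  then show ?thesis
    using any_closest_point_dot[OF S(2,1) _ _ closest] that by blast
qed

section \<open>Epigraphs and affine minorants of convex lower semicontinuous functions\<close>

lemma lsc_eventually_less:
  assumes "lsc f" "s < f u"
  shows "\<forall>\<^sub>F v in nhds u. s < f v"
proof -
  have "\<forall>\<^sub>F v in at u. s < f v"
    using assms le_Liminf_iff[of "f u" "at u" f] unfolding lsc_def by blast
  then show ?thesis
    unfolding eventually_at_filter by eventually_elim (use assms in auto)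
qed

lemma closed_epigraph_lsc:
  fixes f :: "'a::metric_space \<Rightarrow> ereal"
  assumes "lsc f"
  shows "closed {(u, t::real). f u \<le> ereal t}"
  unfolding closed_sequential_limits
proof (intro allI impI, elim conjE)
  fix x l assume x: "\<forall>n. x n \<in> {(u, t::real). f u \<le> ereal t}" and lim: "x \<longlonglongrightarrow> l"
  obtain u t where l: "l = (u, t)" by force
  have lim1: "(\<lambda>n. fst (x n)) \<longlonglongrightarrow> u" and lim2: "(\<lambda>n. ereal (snd (x n))) \<longlonglongrightarrow> ereal t"
    using tendsto_fst[OF lim] tendsto_snd[OF lim] unfolding l by auto
  have "f u \<le> ereal t"
  proof (rule dense_le)
    fix s assume "s < f u"
    from filterlim_iff[THEN iffD1, OF lim1, rule_format, OF lsc_eventually_less[OF assms this]]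
    have "\<forall>\<^sub>F n in sequentially. s \<le> ereal (snd (x n))"
    proof eventually_elim
      case (elim n)
      have "f (fst (x n)) \<le> ereal (snd (x n))"
        using x[rule_format, of n] by (simp add: case_prod_unfold)
      with elim show ?case by simp
    qed
    then show "s \<le> ereal t"
      by (rule tendsto_lowerbound[OF lim2]) simp
  qed
  then show "l \<in> {(u, t::real). f u \<le> ereal t}"
    unfolding l by simp
qed

lemma convex_erealD:
  assumes "convex_ereal f" "f x \<le> ereal a" "f y \<le> ereal b" "0 \<le> t" "t \<le> 1"
  shows "f ((1 - t) *\<^sub>R x + t *\<^sub>R y) \<le> ereal ((1 - t) * a + t * b)"
proof -
  have "f ((1 - t) *\<^sub>R x + t *\<^sub>R y) \<le> ereal (1 - t) * f x + ereal t * f y"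
    using assms unfolding convex_ereal_def by auto
  also have "\<dots> \<le> ereal (1 - t) * ereal a + ereal t * ereal b"
    using assms by (intro add_mono ereal_mult_left_mono) auto
  finally show ?thesis by simp
qed

lemma convex_epigraph_ereal:
  assumes "convex_ereal f"
  shows "convex {(u, t::real). f u \<le> ereal t}"
  unfolding convex_alt using convex_erealD[OF assms] by (auto simp: scaleR_prod_def)

lemma convex_sublevel_ereal:
  assumes "convex_ereal f"
  shows "convex {u. f u \<le> ereal a}"
  unfolding convex_alt
proof (intro ballI allI impI)
  fix x y and t :: real assume "x \<in> {u. f u \<le> ereal a}" "y \<in> {u. f u \<le> ereal a}" "0 \<le> t \<and> t \<le> 1"
  with convex_erealD[OF assms, of x a y a t] show "(1 - t) *\<^sub>R x + t *\<^sub>R y \<in> {u. f u \<le> ereal a}"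
    by (simp add: algebra_simps)
qed

lemma closed_sublevel_lsc:
  fixes f :: "'a::topological_space \<Rightarrow> ereal"
  assumes "lsc f"
  shows "closed {u. f u \<le> c}"
proof -
  have "open {u. c < f u}"
  proof (rule open_subopen[THEN iffD2], intro ballI)
    fix u assume "u \<in> {u. c < f u}"
    then obtain U where "open U" "u \<in> U" "\<forall>v\<in>U. c < f v"
      using lsc_eventually_less[OF assms, of c u] unfolding eventually_nhds by auto
    then show "\<exists>T. open T \<and> u \<in> T \<and> T \<subseteq> {u. c < f u}" by blast
  qed
  moreover have "- {u. f u \<le> c} = {u. c < f u}" by auto
  ultimately show ?thesis
    unfolding closed_def by simp
qed

text \<open>Projection of \<open>(x0, r)\<close> onto the epigraph; the second alternative is the vertical case.\<close>

lemma epigraph_separation: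
  fixes f :: "'a::{real_inner,complete_space} \<Rightarrow> ereal"
  assumes ninf: "\<And>x. f x \<noteq> -\<infinity>" and f: "convex_ereal f" "lsc f" and dom: "edom f \<noteq> {}"
    and r: "ereal r < f x0"
  shows "(\<exists>g c. r < c \<and> (\<forall>u. ereal (c + g \<bullet> (u - x0)) \<le> f u)) \<or>
    (\<exists>g. g \<noteq> 0 \<and> (\<forall>u\<in>edom f. g \<bullet> (u - x0) \<le> - (g \<bullet> g)))"
proof -
  let ?E = "{(u, t::real). f u \<le> ereal t}"
  obtain a where "f a < \<infinity>" using dom unfolding edom_def by blast
  then obtain b where "f a = ereal b" using ninf[of a] by (cases "f a") auto
  then have "(a, b) \<in> ?E" by simp
  then have "?E \<noteq> {}" by blast
  then obtain w where w: "w \<in> ?E" "\<And>e. e \<in> ?E \<Longrightarrow> ((x0, r) - w) \<bullet> (e - w) \<le> 0"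
    using closed_convex_projection[OF closed_epigraph_lsc[OF f(2)] convex_epigraph_ereal[OF f(1)]]
    by metis
  obtain y s where ys: "w = (y, s)" by force
  \<comment> \<open>\<open>(g, - \<beta>)\<close> is the vector from the projection to
    \<open>(x0, r)\<close>, normal to the separating hyperplane; \<open>\<beta> = 0\<close> is the
    vertical case.\<close>
  define g where "g = x0 - y"
  define \<beta> where "\<beta> = s - r"
  have fy: "f y \<le> ereal s" using w(1) ys by simp
  have sep: "g \<bullet> (u - x0) + g \<bullet> g \<le> \<beta> * (t - s)" if "f u \<le> ereal t" for u t
  proof -
    have "((x0, r) - w) \<bullet> ((u, t) - w) \<le> 0"
      using w(2) that by simp
    then show ?thesis
      unfolding ys g_def \<beta>_def by (simp add: algebra_simps inner_commute)
  qed
  \<comment> \<open>The projection raised by one stays in the epigraph, and \<open>sep\<close> there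
    reads \<open>0 \<le> \<beta>\<close>.\<close>
  have "f y \<le> ereal (s + 1)"
    using fy by (rule order_trans) simp
  from sep[OF this] have "\<beta> \<ge> 0"
    unfolding g_def by (simp add: algebra_simps inner_commute)
  then consider "\<beta> > 0" | "\<beta> = 0" by linarith
  then show ?thesis
  proof cases
    case 1
    have "ereal (s + (g \<bullet> g) / \<beta> + ((1/\<beta>) *\<^sub>R g) \<bullet> (u - x0)) \<le> f u" for u
    proof -
      have "s + (g \<bullet> g) / \<beta> + ((1/\<beta>) *\<^sub>R g) \<bullet> (u - x0) \<le> t" if "f u \<le> ereal t" for t
      proof -
        have "(g \<bullet> (u - x0) + g \<bullet> g) / \<beta> \<le> t - s"
          using sep[OF that] 1 by (simp add: pos_divide_le_eq mult.commute)
        then show ?thesis by (simp add: add_divide_distrib)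
      qed
      then show ?thesis
        using ninf[of u] by (cases "f u") auto
    qed
    moreover have "r < s + (g \<bullet> g) / \<beta>"
    proof -
      have "(g \<bullet> g) / \<beta> \<ge> 0" using 1 by simp
      then show ?thesis using 1 unfolding \<beta>_def by linarith
    qed
    ultimately show ?thesis by blast
  next
    case 2
    \<comment> \<open>Otherwise \<open>(x0, r)\<close> would equal its projection and lie in the
      epigraph.\<close>
    have "g \<noteq> 0"
    proof
      assume "g = 0"
      then have "f x0 \<le> ereal r"
        using fy 2 unfolding g_def \<beta>_def by simp
      then show False using r by simp
    qed
    moreover have "g \<bullet> (u - x0) \<le> - (g \<bullet> g)" if u: "u \<in> edom f" for u
    proof -
      obtain t where "f u = ereal t"
        using u ninf[of u] unfolding edom_def by (cases "f u") auto
      then show ?thesis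
        using sep[of u t] 2 by simp
    qed
    ultimately show ?thesis by blast
  qed
qed

text \<open>Separation at \<open>(x0, r)\<close> can be vertical when \<open>x0\<close> is outside
  the domain. A minorant found at a point of the domain is then tilted by a large multiple of the
  vertical functional: the tilt lowers it on the domain but raises its value at \<open>x0\<close> as
  far as desired.\<close>

lemma affine_minorant:
  fixes f :: "'a::{real_inner,complete_space} \<Rightarrow> ereal"
  assumes ninf: "\<And>x. f x \<noteq> -\<infinity>" and f: "convex_ereal f" "lsc f" and r: "ereal r < f x0"
  obtains g c where "r < c" "\<And>u. ereal (c + g \<bullet> (u - x0)) \<le> f u"
proof (cases "edom f = {}")
  case True
  then have "f u = \<infinity>" for u
    unfolding edom_def by auto
  then show ?thesis
    by (intro that[of "r + 1" 0]) auto
next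
  case False
  then obtain a where a: "a \<in> edom f" by blast
  then obtain b where b: "f a = ereal b"
    using ninf[of a] unfolding edom_def by (cases "f a") auto
  obtain g1 c1 where minor: "\<And>u. ereal (c1 + g1 \<bullet> (u - a)) \<le> f u"
  proof -
    \<comment> \<open>As \<open>a\<close> is in the domain, \<open>u = a\<close> in the vertical
      alternative would give \<open>g \<bullet> g \<le> 0\<close>.\<close>
    have "\<not> (\<exists>g. g \<noteq> 0 \<and> (\<forall>u\<in>edom f. g \<bullet> (u - a) \<le> - (g \<bullet> g)))"
    proof
      assume "\<exists>g. g \<noteq> 0 \<and> (\<forall>u\<in>edom f. g \<bullet> (u - a) \<le> - (g \<bullet> g))"
      then obtain g where "g \<noteq> 0" "g \<bullet> (a - a) \<le> - (g \<bullet> g)"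
        using a by blast
      moreover from \<open>g \<noteq> 0\<close> have "g \<bullet> g > 0" by simp
      ultimately show False by (simp only: diff_self inner_zero_right)
    qed
    then show ?thesis
      using epigraph_separation[OF ninf f False, of "b - 1" a] b that by auto
  qed
  from epigraph_separation[OF ninf f False r]
  consider (affine) g c where "r < c" "\<And>u. ereal (c + g \<bullet> (u - x0)) \<le> f u"
    | (vertical) g where "g \<noteq> 0" "\<And>u. u \<in> edom f \<Longrightarrow> g \<bullet> (u - x0) \<le> - (g \<bullet> g)"
    by blast
  then show ?thesis
  proof cases
    case affine
    then show ?thesis using that by blast
  next
    case vertical
    have gg: "g \<bullet> g > 0" using vertical(1) by simp
    \<comment> \<open>\<open>c2\<close> is the value at \<open>x0\<close> of the minorant based at
      \<open>a\<close>; \<open>N\<close> is chosen so that adding \<open>N * (g \<bullet> g)\<close>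
      lifts it strictly above \<open>r\<close>.\<close>
    define c2 where "c2 = c1 + g1 \<bullet> (x0 - a)"
    define N where "N = (\<bar>r - c2\<bar> + 1) / (g \<bullet> g)"
    have N: "N \<ge> 0" "N * (g \<bullet> g) = \<bar>r - c2\<bar> + 1"
      unfolding N_def using gg by auto
    show ?thesis
    proof (rule that)
      show "r < c2 + N * (g \<bullet> g)" using N(2) by linarith
      fix u
      show "ereal (c2 + N * (g \<bullet> g) + (g1 + N *\<^sub>R g) \<bullet> (u - x0)) \<le> f u"
      proof (cases "u \<in> edom f")
        case True
        have "N * (g \<bullet> (u - x0)) \<le> N * (- (g \<bullet> g))"
          using vertical(2)[OF True] N(1) by (rule mult_left_mono)
        then have "c2 + N * (g \<bullet> g) + (g1 + N *\<^sub>R g) \<bullet> (u - x0) \<le> c1 + g1 \<bullet> (u - a)"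
          unfolding c2_def by (simp add: algebra_simps)
        then show ?thesis
          using minor[of u] by (meson ereal_less_eq(3) order_trans)
      qed (simp add: edom_def)
    qed
  qed
qed

section \<open>Moreau envelopes and weak convergence\<close>

lemma moreau_le: "moreau lam f u \<le> f u"
proof -
  have "moreau lam f u \<le> f u + ereal ((norm (u - u))\<^sup>2 / (2 * lam))"
    unfolding moreau_def by (rule INF_lower) simp
  then show ?thesis by (simp add: zero_ereal_def[symmetric])
qed

text \<open>Completing the square: the squared norm of \<open>(u - w) - lam *\<^sub>R g\<close> is
  nonnegative, which bounds the quadratic penalty below by an affine function of
  \<open>w\<close>.\<close>

lemma moreau_ge_affine:
  fixes f :: "'a::real_inner \<Rightarrow> ereal"
  assumes minor: "\<And>u. ereal (c + g \<bullet> (u - x0)) \<le> f u" and lam: "lam > 0"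
  shows "ereal (c + g \<bullet> (u - x0) - lam / 2 * (g \<bullet> g)) \<le> moreau lam f u"
  unfolding moreau_def
proof (rule INF_greatest)
  fix w
  have "0 \<le> (norm ((u - w) - lam *\<^sub>R g))\<^sup>2 / (2 * lam)"
    using lam by simp
  also have "\<dots> = (norm (u - w))\<^sup>2 / (2 * lam) - g \<bullet> (u - w) + lam / 2 * (g \<bullet> g)"
    unfolding power2_norm_eq_inner using lam
    by (simp add: algebra_simps inner_commute add_divide_distrib diff_divide_distrib)
  finally have "c + g \<bullet> (u - x0) - lam / 2 * (g \<bullet> g) \<le> c + g \<bullet> (w - x0) + (norm (u - w))\<^sup>2 / (2 * lam)"
    by (simp add: algebra_simps)
  then have "ereal (c + g \<bullet> (u - x0) - lam / 2 * (g \<bullet> g))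
      \<le> ereal (c + g \<bullet> (w - x0)) + ereal ((norm (u - w))\<^sup>2 / (2 * lam))"
    by simp
  also have "\<dots> \<le> f w + ereal ((norm (u - w))\<^sup>2 / (2 * lam))"
    using minor by (intro add_right_mono)
  finally show "ereal (c + g \<bullet> (u - x0) - lam / 2 * (g \<bullet> g)) \<le> f w + ereal ((norm (u - w))\<^sup>2 / (2 * lam))" .
qed

text \<open>One affine minorant with value above \<open>s\<close> at \<open>x0\<close> suffices:
  weak convergence is tested only against its slope \<open>g\<close>, and the loss
  \<open>lams k / 2 * (g \<bullet> g)\<close> vanishes.\<close>

lemma moreau_weak_lsc:
  fixes f :: "'a::{real_inner,complete_space} \<Rightarrow> ereal"
  assumes f: "\<And>x. f x \<noteq> -\<infinity>" "convex_ereal f" "lsc f" and lams: "\<And>k. lams k > 0" "lams \<longlonglongrightarrow> 0"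
    and x: "weakly_tendsto x x0" and s: "s < f x0"
  shows "\<forall>\<^sub>F k in sequentially. s < moreau (lams k) f (x k)"
proof -
  obtain r where r: "s < ereal r" "ereal r < f x0"
    using ereal_dense2[OF s] by blast
  obtain g c where gc: "r < c" "\<And>u. ereal (c + g \<bullet> (u - x0)) \<le> f u"
    using affine_minorant[OF f r(2)] by metis
  have "(\<lambda>k. x k \<bullet> g) \<longlonglongrightarrow> x0 \<bullet> g"
    using x unfolding weakly_tendsto_def by blast
  then have "(\<lambda>k. c + (x k \<bullet> g - x0 \<bullet> g) - lams k / 2 * (g \<bullet> g)) \<longlonglongrightarrow> c + (x0 \<bullet> g - x0 \<bullet> g) - 0 / 2 * (g \<bullet> g)"
    using lams(2) by (intro tendsto_add tendsto_diff tendsto_mult tendsto_divide tendsto_const) auto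
  then have "\<forall>\<^sub>F k in sequentially. r < c + (x k \<bullet> g - x0 \<bullet> g) - lams k / 2 * (g \<bullet> g)"
    using gc(1) by (intro order_tendstoD(1)) auto
  then show ?thesis
  proof eventually_elim
    case (elim k)
    have "s < ereal r" by (rule r)
    also have "\<dots> < ereal (c + g \<bullet> (x k - x0) - lams k / 2 * (g \<bullet> g))"
      using elim by (simp add: inner_diff_right inner_commute)
    also have "\<dots> \<le> moreau (lams k) f (x k)"
      by (rule moreau_ge_affine[OF gc(2) lams(1)])
    finally show ?case .
  qed
qed

text \<open>A diagonal argument makes the inner products with a countable dense set converge, and
  boundedness extends this to all vectors. The limit is a common point of the closed convex hulls of
  the tails: every inner product confines the tails to arbitrarily thin slabs.\<close>

lemma bounded_weakly_convergent_subsequence: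
  fixes x :: "nat \<Rightarrow> 'a::{real_inner,complete_space,second_countable_topology}"
  assumes "bounded (range x)"
  obtains l r where "strict_mono r" "weakly_tendsto (x \<circ> r) l"
proof -
  obtain B where B: "\<And>n. norm (x n) \<le> B"
    using assms unfolding bounded_iff by blast
  have B0: "B \<ge> 0" using B[of 0] norm_ge_zero order_trans by blast
  obtain D :: "'a set" where D: "countable D" "\<And>X. open X \<Longrightarrow> X \<noteq> {} \<Longrightarrow> \<exists>d\<in>D. d \<in> X"
    by (rule countable_dense_setE) blast
  have D_ne: "D \<noteq> {}" using D(2)[of UNIV] by auto
  define d where "d = from_nat_into D"
  interpret subseqs "\<lambda>n s. convergent (\<lambda>k. x (s k) \<bullet> d n)"
  proof
    fix n and s :: "nat \<Rightarrow> nat" assume "strict_mono s"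
    have "bounded (range (\<lambda>k. x (s k) \<bullet> d n))"
      unfolding bounded_iff
    proof (intro exI[of _ "B * norm (d n)"] ballI)
      fix t assume "t \<in> range (\<lambda>k. x (s k) \<bullet> d n)"
      then obtain k where "t = x (s k) \<bullet> d n" by blast
      then show "norm t \<le> B * norm (d n)"
        using Cauchy_Schwarz_ineq2[of "x (s k)" "d n"] B[of "s k"]
        by (simp add: mult_right_mono order_trans)
    qed
    then obtain l r where "strict_mono (r::nat\<Rightarrow>nat)" "((\<lambda>k. x (s k) \<bullet> d n) \<circ> r) \<longlonglongrightarrow> l"
      using bounded_imp_convergent_subsequence by blast
    then show "\<exists>r'. strict_mono r' \<and> convergent (\<lambda>k. x ((s \<circ> r') k) \<bullet> d n)"
      by (auto simp: convergent_def o_def)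
  qed
  define y where "y = x \<circ> diagseq"
  have conv_d: "convergent (\<lambda>k. y k \<bullet> d n)" for n
  proof -
    have "convergent (\<lambda>k. x ((diagseq \<circ> (+) (Suc n)) k) \<bullet> d n)"
    proof (rule diagseq_holds)
      fix r s :: "nat \<Rightarrow> nat" and n assume "strict_mono r" "convergent (\<lambda>k. x (s k) \<bullet> d n)"
      then show "convergent (\<lambda>k. x ((s \<circ> r) k) \<bullet> d n)"
        using convergent_subseq_convergent[of "\<lambda>k. x (s k) \<bullet> d n" r] by (simp add: o_def)
    qed
    then have "convergent (\<lambda>k. y (k + Suc n) \<bullet> d n)"
      by (simp add: y_def add.commute)
    then show ?thesis
      by (rule convergent_ignore_initial_segment[THEN iffD1])
  qed
  have yB: "norm (y k) \<le> B" for k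
    using B by (simp add: y_def)
  have conv: "convergent (\<lambda>k. y k \<bullet> v)" for v
  proof (rule Cauchy_convergent, rule CauchyI)
    fix e :: real assume e: "e > 0"
    \<comment> \<open>Chosen so that replacing \<open>v\<close> by \<open>d n\<close> costs at most
      \<open>e / 4\<close> twice, next to \<open>e / 4\<close> for the Cauchy difference;
      \<open>B + 1\<close> guards against \<open>B = 0\<close>.\<close>
    define \<delta> where "\<delta> = e / (4 * (B + 1))"
    have \<delta>: "\<delta> > 0" using e B0 by (simp add: \<delta>_def)
    have B\<delta>: "B * \<delta> \<le> e / 4"
      using e B0 by (simp add: \<delta>_def field_simps)
    obtain w where "w \<in> D" "w \<in> ball v \<delta>"
      using D(2)[of "ball v \<delta>"] \<delta> by auto
    then obtain n where n: "d n \<in> ball v \<delta>"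
      unfolding d_def using from_nat_into_surj[OF D(1)] by metis
    obtain N where N: "\<And>k m. k \<ge> N \<Longrightarrow> m \<ge> N \<Longrightarrow> norm (y k \<bullet> d n - y m \<bullet> d n) < e / 4"
      using convergent_Cauchy[OF conv_d[of n]] e unfolding Cauchy_iff by (meson zero_less_divide_iff zero_less_numeral)
    have near: "\<bar>y k \<bullet> v - y k \<bullet> d n\<bar> \<le> e / 4" for k
    proof -
      have "\<bar>y k \<bullet> v - y k \<bullet> d n\<bar> \<le> norm (y k) * norm (v - d n)"
        using Cauchy_Schwarz_ineq2[of "y k" "v - d n"] by (simp add: inner_diff_right)
      also have "\<dots> \<le> B * \<delta>"
        using n yB[of k] B0 by (intro mult_mono) (auto simp: dist_norm)
      finally show ?thesis using B\<delta> by linarith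
    qed
    show "\<exists>M. \<forall>m\<ge>M. \<forall>n\<ge>M. norm (y m \<bullet> v - y n \<bullet> v) < e"
    proof (intro exI[of _ N] allI impI)
      fix k m assume "k \<ge> N" "m \<ge> N"
      from N[OF this] near[of k] near[of m] show "norm (y k \<bullet> v - y m \<bullet> v) < e"
        unfolding real_norm_def by linarith
    qed
  qed
  define S where "S n = closure (convex hull (y ` {n..}))" for n
  obtain l where l: "\<And>n. l \<in> S n"
  proof (rule nested_closed_convex_Inter)
    show "closed (S n)" "convex (S n)" "S n \<noteq> {}" for n
      unfolding S_def by (auto intro: convex_closure)
    show "decseq S"
      unfolding decseq_def S_def by (auto intro!: closure_mono hull_mono image_mono)
    have "bounded (range y)"
      using yB unfolding bounded_iff by blast
    then have "bounded (y ` {0..})"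
      by (rule bounded_subset) auto
    then show "bounded (S 0)"
      unfolding S_def by (intro bounded_closure bounded_convex_hull)
  qed blast
  have "weakly_tendsto y l"
    unfolding weakly_tendsto_def
  proof
    fix v
    obtain L where L: "(\<lambda>k. y k \<bullet> v) \<longlonglongrightarrow> L"
      using conv[of v] unfolding convergent_def by blast
    have "\<bar>l \<bullet> v - L\<bar> \<le> 0 + e" if e: "e > 0" for e
    proof -
      obtain n where n: "\<And>k. k \<ge> n \<Longrightarrow> \<bar>y k \<bullet> v - L\<bar> < e"
        using L e unfolding lim_sequentially dist_real_def by blast
      let ?H = "{u. v \<bullet> u \<ge> L - e} \<inter> {u. v \<bullet> u \<le> L + e}"
      have "y ` {n..} \<subseteq> ?H"
        using n by (force simp: inner_commute abs_less_iff)
      moreover have "convex ?H"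
        by (intro convex_Int convex_halfspace_ge convex_halfspace_le)
      moreover have "closed ?H"
        by (intro closed_Int closed_halfspace_ge closed_halfspace_le)
      ultimately have "S n \<subseteq> ?H"
        unfolding S_def by (intro closure_minimal hull_minimal)
      then show ?thesis
        using l[of n] by (auto simp: inner_commute abs_le_iff)
    qed
    then have "\<bar>l \<bullet> v - L\<bar> \<le> 0" by (rule field_le_epsilon)
    with L show "(\<lambda>k. y k \<bullet> v) \<longlonglongrightarrow> l \<bullet> v" by simp
  qed
  then show ?thesis
    using that[OF subseq_diagseq] by (simp add: y_def)
qed

text \<open>Otherwise the sublevel sets at levels \<open>- real n\<close> would be nonempty, nested,
  closed, convex and bounded, and a common point would have value
  \<open>-\<infinity>\<close>.\<close>

lemma coercive_bounded_below:
  fixes f :: "'a::{real_inner,complete_space} \<Rightarrow> ereal"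
  assumes ninf: "\<And>x. f x \<noteq> -\<infinity>" and f: "convex_ereal f" "lsc f" "coercive f"
  obtains m :: real where "\<And>x. ereal m \<le> f x"
proof (rule ccontr)
  assume "\<not> thesis"
  then have "\<exists>x. f x < ereal m" for m
    using that by (meson not_le)
  then have ne: "{x. f x \<le> ereal (- real n)} \<noteq> {}" for n
    using less_imp_le by blast
  obtain x where x: "\<And>n. x \<in> {x. f x \<le> ereal (- real n)}"
  proof (rule nested_closed_convex_Inter[of "\<lambda>n. {x. f x \<le> ereal (- real n)}"])
    show "decseq (\<lambda>n. {x. f x \<le> ereal (- real n)})"
      unfolding decseq_def by (auto elim: order_trans)
    show "bounded {x. f x \<le> ereal (- real 0)}"
      using f(3) unfolding coercive_def by blast
  qed (use ne convex_sublevel_ereal[OF f(1)] closed_sublevel_lsc[OF f(2)] in auto)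
  obtain b where b: "f x = ereal b"
    using ninf[of x] x[of 0] by (cases "f x") auto
  obtain n where "- b < real n" using reals_Archimedean2 by blast
  then show False using x[of n] b by simp
qed

subsection \<open>Subgradients and strong convergence\<close>

text \<open>Baire's theorem yields a ball on which \<open>F\<close> is bounded above, and convexity
  carries the bound to a neighbourhood of \<open>x0\<close>. It bounds the slopes of affine
  minorants that are nearly exact at \<open>x0\<close>; a weak limit of these slopes is a
  subgradient.\<close>

lemma lsc_convex_subgradient_exists:
  fixes F :: "'a::{real_inner,complete_space,second_countable_topology} \<Rightarrow> real"
  assumes f: "convex_ereal (\<lambda>x. ereal (F x))" "lsc (\<lambda>x. ereal (F x))"
  obtains z where "\<And>u. F x0 + z \<bullet> (u - x0) \<le> F u"
proof -
  let ?L = "\<lambda>n. {x. ereal (F x) \<le> ereal (real n)}"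
  have "\<exists>n. interior (?L n) \<noteq> {}"
  proof (rule ccontr)
    assume "\<not> ?thesis"
    then have "euclidean interior_of \<Union>(range ?L) = {}"
      using closed_sublevel_lsc[OF f(2)]
      by (intro Baire_category_alt disjI1 completely_metrizable_space_euclidean)
        (auto simp del: ereal_less_eq)
    moreover have "\<Union>(range ?L) = UNIV"
      using real_arch_simple by auto
    ultimately show False by simp
  qed
  then obtain n a where "a \<in> interior (?L n)" by blast
  then obtain \<rho> where \<rho>: "\<rho> > 0" "ball a \<rho> \<subseteq> ?L n"
    unfolding mem_interior by blast
  \<comment> \<open>\<open>x0 + u\<close> is the midpoint of \<open>a + 2 *\<^sub>R u\<close>, which
    lies in the ball, and the reflected point \<open>2 *\<^sub>R x0 - a\<close>.\<close>
  define B where "B = (1/2) * real n + (1/2) * F (2 *\<^sub>R x0 - a)"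
  have bound: "F (x0 + u) \<le> B" if "norm u < \<rho> / 2" for u
  proof -
    have "a + 2 *\<^sub>R u \<in> ball a \<rho>"
      using that by (simp add: dist_norm)
    then have "ereal (F (a + 2 *\<^sub>R u)) \<le> ereal (real n)"
      using \<rho>(2) by blast
    from convex_erealD[OF f(1) this order_refl, of "1/2" "2 *\<^sub>R x0 - a"]
    show ?thesis by (simp add: B_def algebra_simps)
  qed
  have "\<exists>g c. F x0 - 1 / Suc k < c \<and> (\<forall>u. c + g \<bullet> (u - x0) \<le> F u)" for k
  proof (rule affine_minorant[OF _ f, of "F x0 - 1 / Suc k" x0])
    fix c g assume "F x0 - 1 / Suc k < c" "\<And>u. ereal (c + g \<bullet> (u - x0)) \<le> ereal (F u)"
    then show ?thesis by (intro exI[of _ g] exI[of _ c]) simp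
  qed auto
  then obtain g c where gc: "\<And>k. F x0 - 1 / Suc k < c k" "\<And>k u. c k + g k \<bullet> (u - x0) \<le> F u"
    by metis
  have "norm (g k) \<le> (B - F x0 + 1) * 4 / \<rho>" for k
  proof -
    \<comment> \<open>Testing the minorant in the direction of its own slope turns the bound
      \<open>B\<close> on values into a bound on \<open>norm (g k)\<close>.\<close>
    define u where "u = (\<rho> / 4) *\<^sub>R sgn (g k)"
    have "norm u \<le> \<rho> / 4"
      using \<rho>(1) by (simp add: u_def norm_sgn)
    then have "F (x0 + u) \<le> B"
      using \<rho>(1) by (intro bound) simp
    moreover have "g k \<bullet> u = \<rho> / 4 * norm (g k)"
      by (cases "g k = 0") (simp_all add: u_def sgn_div_norm power2_norm_eq_inner[symmetric] power2_eq_square)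
    moreover have "1 / real (Suc k) \<le> 1" by simp
    ultimately have "\<rho> / 4 * norm (g k) \<le> B - F x0 + 1"
      using gc(1)[of k] gc(2)[of k "x0 + u"] unfolding add_diff_cancel_left' by linarith
    then show ?thesis
      using \<rho>(1) by (simp add: field_simps)
  qed
  then have "bounded (range g)"
    unfolding bounded_iff by blast
  then obtain z r where z: "strict_mono r" "weakly_tendsto (g \<circ> r) z"
    using bounded_weakly_convergent_subsequence by metis
  show ?thesis
  proof (rule that)
    fix u
    have "(\<lambda>k. 1 / real (Suc (r k))) \<longlonglongrightarrow> 0"
      using LIMSEQ_subseq_LIMSEQ[OF lim_1_over_n[THEN LIMSEQ_Suc] z(1)] by (simp add: o_def)
    moreover have "(\<lambda>k. g (r k) \<bullet> (u - x0)) \<longlonglongrightarrow> z \<bullet> (u - x0)"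
      using z(2) unfolding weakly_tendsto_def by simp
    ultimately have "(\<lambda>k. F x0 - 1 / real (Suc (r k)) + g (r k) \<bullet> (u - x0)) \<longlonglongrightarrow> F x0 - 0 + z \<bullet> (u - x0)"
      by (intro tendsto_add tendsto_diff tendsto_const)
    moreover have "F x0 - 1 / real (Suc (r k)) + g (r k) \<bullet> (u - x0) \<le> F u" for k
      using gc(1)[of "r k"] gc(2)[of "r k" u] by linarith
    ultimately show "F x0 + z \<bullet> (u - x0) \<le> F u"
      using LIMSEQ_le_const2 by fastforce
  qed
qed

section \<open>Conjugates, their differentiability and strong convergence\<close>

lemma conjugate_ge: "ereal (z \<bullet> y) - f y \<le> conjugate f z"
  unfolding conjugate_def by (rule SUP_upper) simp

text \<open>A subgradient makes the Fenchel-Young inequality an equality at \<open>x0\<close>; using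
  \<open>y = x0\<close> in the supremum at any other \<open>u\<close> then inverts the subgradient
  relation.\<close>

lemma conjugate_subgradient:
  assumes z: "\<And>u. F x0 + z \<bullet> (u - x0) \<le> F u"
  shows "conjugate (\<lambda>x. ereal (F x)) z = ereal (z \<bullet> x0 - F x0)"
    and "x0 \<in> subdifferential (conjugate (\<lambda>x. ereal (F x))) z"
proof -
  let ?f = "\<lambda>x. ereal (F x)"
  show conj: "conjugate ?f z = ereal (z \<bullet> x0 - F x0)"
  proof (rule antisym)
    show "conjugate ?f z \<le> ereal (z \<bullet> x0 - F x0)"
      unfolding conjugate_def using z by (intro SUP_least) (simp add: algebra_simps)
    show "ereal (z \<bullet> x0 - F x0) \<le> conjugate ?f z"
      using conjugate_ge[of z x0 ?f] by simp
  qed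
  have "conjugate ?f z + ereal (x0 \<bullet> (u - z)) \<le> conjugate ?f u" for u
  proof -
    have "conjugate ?f z + ereal (x0 \<bullet> (u - z)) = ereal (u \<bullet> x0) - ?f x0"
      unfolding conj by (simp add: algebra_simps inner_commute)
    also have "\<dots> \<le> conjugate ?f u" by (rule conjugate_ge)
    finally show ?thesis .
  qed
  then show "x0 \<in> subdifferential (conjugate ?f) z"
    unfolding subdifferential_def by (simp add: conj)
qed

text \<open>Subtracting \<open>x \<bullet> u\<close> leaves a local minimum at \<open>z\<close>, so
  the derivative of \<open>f\<close> at \<open>z\<close> is the inner product with
  \<open>x\<close>.\<close>

lemma frechet_differentiable_subgradient:
  fixes f :: "'a::real_inner \<Rightarrow> ereal"
  assumes diff: "frechet_differentiable_at f z" and sub: "x \<in> subdifferential f z" and e: "e > 0"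
  obtains d where "d > 0"
    "\<And>v. norm v \<le> d \<Longrightarrow> f (z + v) \<le> f z + ereal (x \<bullet> v + e * norm v)"
proof -
  define G where "G u = real_of_ereal (f u)" for u
  have fin: "\<forall>\<^sub>F u in nhds z. \<bar>f u\<bar> \<noteq> \<infinity>"
    using diff unfolding frechet_differentiable_at_def by blast
  then obtain \<rho> where \<rho>: "\<rho> > 0" "\<And>u. u \<in> ball z \<rho> \<Longrightarrow> \<bar>f u\<bar> \<noteq> \<infinity>"
    unfolding eventually_nhds_metric by (auto simp: dist_commute)
  have fG: "f u = ereal (G u)" if "u \<in> ball z \<rho>" for u
    using \<rho>(2)[OF that] unfolding G_def by (simp add: ereal_real)
  have z_mem: "z \<in> ball z \<rho>" using \<rho>(1) by simp
  obtain D where D: "(G has_derivative D) (at z)"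
    using diff unfolding frechet_differentiable_at_def differentiable_def G_def by blast
  have "((\<lambda>u. G u - x \<bullet> u) has_derivative (\<lambda>v. D v - x \<bullet> v)) (at z)"
    by (intro has_derivative_diff D has_derivative_inner_right has_derivative_ident)
  moreover have "G z - x \<bullet> z \<le> G u - x \<bullet> u" if "u \<in> ball z \<rho>" for u
  proof -
    have "f z + ereal (x \<bullet> (u - z)) \<le> f u"
      using sub unfolding subdifferential_def by blast
    then show ?thesis
      unfolding fG[OF that] fG[OF z_mem] by (simp add: algebra_simps)
  qed
  ultimately have "(\<lambda>v. D v - x \<bullet> v) = (\<lambda>v. 0)"
    using differential_zero_maxmin[OF z_mem open_ball] by blast
  then have D_eq: "D v = x \<bullet> v" for v
    by (meson eq_iff_diff_eq_0)
  obtain d where d: "d > 0" "\<And>y. norm (y - z) < d \<Longrightarrow> norm (G y - G z - D (y - z)) \<le> e * norm (y - z)"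
    using D e unfolding has_derivative_at_alt by blast
  show ?thesis
  proof (rule that)
    show "min d \<rho> / 2 > 0" using d(1) \<rho>(1) by simp
    fix v :: 'a assume v: "norm v \<le> min d \<rho> / 2"
    then have "norm v < d" "norm v < \<rho>"
      using d(1) \<rho>(1) by (auto simp: min_def split: if_splits)
    then have "z + v \<in> ball z \<rho>" and "norm (G (z + v) - G z - D v) \<le> e * norm v"
      using d(2)[of "z + v"] by (auto simp: dist_norm)
    then show "f (z + v) \<le> f z + ereal (x \<bullet> v + e * norm v)"
      unfolding fG[OF \<open>z + v \<in> ball z \<rho>\<close>] fG[OF z_mem] D_eq by (simp add: abs_le_iff algebra_simps)
  qed
qed

text \<open>
  Frechet differentiability of the conjugate at a subgradient \<open>z\<close> of \<open>F\<close> at \<open>x0\<close> bounds the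
  conjugate from above near \<open>z\<close>. Dually, \<open>F\<close> has affine minorants with slopes \<open>z + v\<close> for all
  small \<open>v\<close>; taking \<open>v\<close> in the direction of \<open>x k - x0\<close> controls the norm of \<open>x k - x0\<close>.
\<close>

lemma weak_imp_strong_convergence:
  fixes F :: "'a::{real_inner,complete_space,second_countable_topology} \<Rightarrow> real"
  defines "f \<equiv> \<lambda>x. ereal (F x)"
  assumes f: "convex_ereal f" "lsc f"
    and diff: "\<And>z. z \<in> dom_subdifferential (conjugate f) \<Longrightarrow> frechet_differentiable_at (conjugate f) z"
    and lams: "\<And>k. lams k > 0" "lams \<longlonglongrightarrow> 0"
    and x: "weakly_tendsto x x0" and le: "\<And>k. moreau (lams k) f (x k) \<le> f x0"
  shows "x \<longlonglongrightarrow> x0"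
proof -
  obtain z where z: "\<And>u. F x0 + z \<bullet> (u - x0) \<le> F u"
    using lsc_convex_subgradient_exists f unfolding f_def by blast
  note conj = conjugate_subgradient[OF z, folded f_def]
  have frechet: "frechet_differentiable_at (conjugate f) z"
    using diff conj(2) unfolding dom_subdifferential_def by blast
  have "\<forall>\<^sub>F k in sequentially. dist (x k) x0 < e" if e: "e > 0" for e
  proof -
    obtain d where d: "d > 0"
      "\<And>v. norm v \<le> d \<Longrightarrow> conjugate f (z + v) \<le> conjugate f z + ereal (x0 \<bullet> v + (e / 2) * norm v)"
      using frechet_differentiable_subgradient[OF frechet conj(2), of "e / 2"] e by auto
    \<comment> \<open>Fenchel-Young for the slope \<open>z + v\<close>, with the conjugate bounded
      above by differentiability; the error is made uniform in \<open>v\<close> by replacing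
      \<open>norm v\<close> with \<open>d\<close>.\<close>
    have minor: "F x0 + z \<bullet> (u - x0) + v \<bullet> (u - x0) - (e / 2) * d \<le> F u" if v: "norm v \<le> d" for u v
    proof -
      have "ereal ((z + v) \<bullet> u - F u) \<le> conjugate f (z + v)"
        using conjugate_ge[of "z + v" u f] by (simp add: f_def)
      also have "\<dots> \<le> ereal (z \<bullet> x0 - F x0 + (x0 \<bullet> v + (e / 2) * norm v))"
        using d(2)[OF v] unfolding conj(1) by simp
      finally have "(z + v) \<bullet> u - F u \<le> z \<bullet> x0 - F x0 + x0 \<bullet> v + (e / 2) * norm v"
        by simp
      moreover have "(e / 2) * norm v \<le> (e / 2) * d"
        using v e by (intro mult_left_mono) auto
      ultimately show ?thesis
        by (simp add: algebra_simps inner_commute)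
    qed
    have bound: "d * norm (x k - x0) \<le> (e / 2) * d + lams k / 2 * (norm z + d)\<^sup>2 - (x k \<bullet> z - x0 \<bullet> z)" for k
    proof -
      \<comment> \<open>Aligned with \<open>x k - x0\<close>, so that the minorant grows by
        \<open>d * norm (x k - x0)\<close>; it is 0 when the two points coincide.\<close>
      define v where "v = d *\<^sub>R sgn (x k - x0)"
      have v: "norm v \<le> d"
        using d(1) by (simp add: v_def norm_sgn)
      have v_inner: "v \<bullet> (x k - x0) = d * norm (x k - x0)"
        by (cases "x k = x0") (simp_all add: v_def sgn_div_norm power2_norm_eq_inner[symmetric] power2_eq_square)
      then have slope: "(z + v) \<bullet> (x k - x0) = (x k \<bullet> z - x0 \<bullet> z) + d * norm (x k - x0)"
        by (simp add: inner_add_left inner_diff_right inner_commute[of z])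
      have "ereal (F x0 - (e / 2) * d + (z + v) \<bullet> (u - x0)) \<le> f u" for u
        using minor[OF v, of u] by (simp add: f_def inner_add_left)
      from moreau_ge_affine[OF this lams(1), of "x k" k] le[of k]
      have "ereal (F x0 - (e / 2) * d + (z + v) \<bullet> (x k - x0) - lams k / 2 * ((z + v) \<bullet> (z + v))) \<le> f x0"
        by (rule order_trans)
      then have "d * norm (x k - x0) \<le> (e / 2) * d + lams k / 2 * ((z + v) \<bullet> (z + v)) - (x k \<bullet> z - x0 \<bullet> z)"
        unfolding f_def slope by simp
      moreover have "(z + v) \<bullet> (z + v) \<le> (norm z + d)\<^sup>2"
        unfolding power2_norm_eq_inner[symmetric]
        using norm_triangle_ineq[of z v] v by (intro power_mono) auto
      then have "lams k / 2 * ((z + v) \<bullet> (z + v)) \<le> lams k / 2 * (norm z + d)\<^sup>2"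
        using lams(1)[of k] by (intro mult_left_mono) auto
      ultimately show ?thesis by linarith
    qed
    have "(\<lambda>k. x k \<bullet> z) \<longlonglongrightarrow> x0 \<bullet> z"
      using x unfolding weakly_tendsto_def by blast
    then have "(\<lambda>k. (e / 2) * d + lams k / 2 * (norm z + d)\<^sup>2 - (x k \<bullet> z - x0 \<bullet> z))
        \<longlonglongrightarrow> (e / 2) * d + 0 / 2 * (norm z + d)\<^sup>2 - (x0 \<bullet> z - x0 \<bullet> z)"
      using lams(2) by (intro tendsto_add tendsto_diff tendsto_mult tendsto_divide tendsto_const) auto
    moreover have "(e / 2) * d + 0 / 2 * (norm z + d)\<^sup>2 - (x0 \<bullet> z - x0 \<bullet> z) < e * d"
      using e d(1) by simp
    ultimately have "\<forall>\<^sub>F k in sequentially.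
        (e / 2) * d + lams k / 2 * (norm z + d)\<^sup>2 - (x k \<bullet> z - x0 \<bullet> z) < e * d"
      by (rule order_tendstoD(2))
    then show ?thesis
    proof eventually_elim
      case (elim k)
      then have "d * norm (x k - x0) < d * e"
        using bound[of k] by (simp add: mult.commute)
      then show ?case
        using d(1) by (simp add: dist_norm)
    qed
  qed
  then show ?thesis
    by (rule tendstoI)
qed

subsection \<open>Envelopes of suprema and chance constraints\<close>

lemma convex_ereal_SUP:
  assumes "\<And>v. v \<in> C \<Longrightarrow> convex_on UNIV (F v)"
  shows "convex_ereal (\<lambda>x. SUP v\<in>C. ereal (F v x))"
  unfolding convex_ereal_def
proof (intro allI ballI SUP_least)
  fix x y and t :: real and v assume t: "t \<in> {0..1}" and v: "v \<in> C"
  have "ereal (F v ((1 - t) *\<^sub>R x + t *\<^sub>R y)) \<le> ereal (1 - t) * ereal (F v x) + ereal t * ereal (F v y)"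
    using convex_onD[OF assms[OF v], of t x y] t by simp
  also have "\<dots> \<le> ereal (1 - t) * (SUP v\<in>C. ereal (F v x)) + ereal t * (SUP v\<in>C. ereal (F v y))"
    using t v by (intro add_mono ereal_mult_left_mono SUP_upper) auto
  finally show "ereal (F v ((1 - t) *\<^sub>R x + t *\<^sub>R y))
      \<le> ereal (1 - t) * (SUP v\<in>C. ereal (F v x)) + ereal t * (SUP v\<in>C. ereal (F v y))" .
qed

lemma lsc_SUP:
  assumes "\<And>v. v \<in> C \<Longrightarrow> continuous_on UNIV (F v)"
  shows "lsc (\<lambda>x. SUP v\<in>C. ereal (F v x))"
  unfolding lsc_def le_Liminf_iff
proof (intro allI impI)
  fix x s assume "s < (SUP v\<in>C. ereal (F v x))"
  then obtain v where v: "v \<in> C" "s < ereal (F v x)"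
    unfolding less_SUP_iff by blast
  have "(F v \<longlongrightarrow> F v x) (at x)"
    using assms[OF v(1)] unfolding continuous_on_def by simp
  then have "((\<lambda>u. ereal (F v u)) \<longlongrightarrow> ereal (F v x)) (at x)"
    by (rule tendsto_ereal)
  from order_tendstoD(1)[OF this v(2)]
  show "\<forall>\<^sub>F u in at x. s < (SUP v\<in>C. ereal (F v u))"
    by eventually_elim (use v(1) in \<open>auto simp: less_SUP_iff\<close>)
qed

text \<open>An infimum lies below \<open>a\<close> iff one of its terms does, so the set is a union
  of open sets.\<close>

lemma open_moreau_less:
  fixes f :: "'a::real_normed_vector \<Rightarrow> ereal"
  shows "open {u. moreau lam f u < a}"
proof -
  have "open {u. f w + ereal ((norm (u - w))\<^sup>2 / (2 * lam)) < a}" for w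
  proof (cases "f w")
    case (real r)
    have "open {u. ereal (r + (norm (u - w))\<^sup>2 * (1 / (2 * lam))) < a}"
      by (intro open_Collect_less continuous_on_ereal continuous_intros)
    then show ?thesis by (simp add: real)
  qed auto
  then have "open (\<Union>w. {u. f w + ereal ((norm (u - w))\<^sup>2 / (2 * lam)) < a})"
    by blast
  also have "(\<Union>w. {u. f w + ereal ((norm (u - w))\<^sup>2 / (2 * lam)) < a}) = {u. moreau lam f u < a}"
    unfolding moreau_def INF_less_iff by auto
  finally show ?thesis .
qed

text \<open>The non-strict bound is the countable intersection of the strict bounds at
  \<open>c + 1 / Suc n\<close>, each the preimage of an open set.\<close>

lemma sets_moreau_le:
  fixes f :: "'a::real_normed_vector \<times> 'b::real_normed_vector \<Rightarrow> ereal"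
  assumes \<xi>: "\<xi> \<in> borel_measurable \<Omega>"
  shows "{\<omega> \<in> space \<Omega>. moreau lam f (x, \<xi> \<omega>) \<le> ereal c} \<in> sets \<Omega>"
proof -
  have "open ((\<lambda>z. (x, z)) -` {u. moreau lam f u < ereal (c + 1 / Suc n)})" for n
    by (intro open_vimage open_moreau_less continuous_intros)
  then have "\<xi> -` ((\<lambda>z. (x, z)) -` {u. moreau lam f u < ereal (c + 1 / Suc n)}) \<inter> space \<Omega> \<in> sets \<Omega>" for n
    by (intro measurable_sets[OF \<xi>] borel_open)
  then have "(\<Inter>n. \<xi> -` ((\<lambda>z. (x, z)) -` {u. moreau lam f u < ereal (c + 1 / Suc n)}) \<inter> space \<Omega>) \<in> sets \<Omega>"
    by (intro sets.countable_INT) auto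
  also have "(\<Inter>n. \<xi> -` ((\<lambda>z. (x, z)) -` {u. moreau lam f u < ereal (c + 1 / Suc n)}) \<inter> space \<Omega>) =
      {\<omega> \<in> space \<Omega>. moreau lam f (x, \<xi> \<omega>) \<le> ereal c}"
  proof -
    have "e \<le> ereal c \<longleftrightarrow> (\<forall>n. e < ereal (c + 1 / Suc n))" for e
    proof
      assume "e \<le> ereal c"
      moreover have "ereal c < ereal (c + 1 / Suc n)" for n by simp
      ultimately show "\<forall>n. e < ereal (c + 1 / Suc n)"
        using le_less_trans by blast
    next
      assume less: "\<forall>n. e < ereal (c + 1 / Suc n)"
      show "e \<le> ereal c"
      proof (rule ereal_le_epsilon2)
        fix r :: real assume "0 < r"
        then obtain n where "1 / Suc n < r" using nat_approx_posE by blast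
        then have "ereal (c + 1 / Suc n) \<le> ereal c + ereal r" by simp
        with less show "e \<le> ereal c + ereal r"
          by (meson less_le_trans less_imp_le)
      qed
    qed
    then show ?thesis by auto
  qed
  finally show ?thesis .
qed

text \<open>A reverse Fatou argument: the tail unions \<open>U n\<close> have measure at least
  \<open>p\<close> and decrease to the set of points lying in infinitely many \<open>A k\<close>, so
  continuity from above applies.\<close>

lemma (in finite_measure) measure_ge_limsup:
  assumes A: "\<And>k. A k \<in> sets M" "\<And>k. p \<le> measure M (A k)" and B: "B \<in> sets M"
    and sub: "\<And>\<omega>. \<omega> \<in> space M \<Longrightarrow> \<exists>\<^sub>F k in sequentially. \<omega> \<in> A k \<Longrightarrow> \<omega> \<in> B"
  shows "p \<le> measure M B"
proof -
  define U where "U n = (\<Union>k\<in>{n..}. A k)" for n :: nat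
  have U: "U n \<in> sets M" for n
    unfolding U_def using A(1) by (intro sets.countable_UN') auto
  have "(\<lambda>n. measure M (U n)) \<longlonglongrightarrow> measure M (\<Inter>n. U n)"
    using U by (intro finite_Lim_measure_decseq) (auto simp: decseq_def U_def intro: order_trans)
  moreover have "p \<le> measure M (U n)" for n
    using A(2)[of n] finite_measure_mono[OF _ U, of "A n" n] by (force simp: U_def)
  ultimately have "p \<le> measure M (\<Inter>n. U n)"
    using LIMSEQ_le_const by blast
  also have "\<dots> \<le> measure M B"
  proof (rule finite_measure_mono[OF _ B], rule subsetI)
    fix \<omega> assume \<omega>: "\<omega> \<in> (\<Inter>n. U n)"
    have "\<omega> \<in> space M"
      using \<omega> sets.sets_into_space[OF U[of 0]] by blast
    moreover have "\<exists>\<^sub>F k in sequentially. \<omega> \<in> A k"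
      using \<omega> unfolding U_def frequently_sequentially by auto
    ultimately show "\<omega> \<in> B" by (rule sub)
  qed
  finally show ?thesis .
qed

text \<open>\<open>seq_weakly_continuous h\<close> guards the convergence of values too: the
  near-optimal points extracted there converge only weakly, and the thresholds
  \<open>h (x k)\<close> have to converge along them. Closedness of \<open>K\<close> serves both the
  separation and the measurability of the events.\<close>

theorem theorem5p4:
  fixes K :: "'y::banach set"
    and C :: "('y \<Rightarrow>\<^sub>L real) set"
    and \<Phi> :: "'h::{real_inner, complete_space, second_countable_topology} \<times> (real ^ 'm) \<Rightarrow> 'y"
    and h :: "'h \<Rightarrow> real"
    and \<Omega> :: "'w measure"
    and \<xi> :: "'w \<Rightarrow> real ^ 'm"
    and \<psi> :: "'h \<Rightarrow> ereal"
    and p :: real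
  defines "M \<equiv> feasible (prob_fun \<Omega> \<xi> K \<Phi>) p"
    and "M_env \<equiv> \<lambda>lam. feasible (prob_fun_env \<Omega> \<xi> C \<Phi> h lam) p"
  assumes K: "K \<noteq> {}" "convex K" "cone K" "closed K"
    and C: "compactin weak_star_topology C" "convex C"
      "weak_star_topology closure_of (cone_of C) = dual_cone K"
    and \<Phi>: "continuous_on UNIV \<Phi>"
    and h: "continuously_differentiable h" "convex_on UNIV h"
    and cvx: "\<And>v. v \<in> C \<Longrightarrow> convex_on UNIV (\<lambda>(x, z). blinfun_apply v (\<Phi> (x, z)) + h x)"
    and \<xi>: "prob_space \<Omega>" "\<exists>g. distributed \<Omega> lborel \<xi> g"
    and p: "p \<in> {0..1}"
    and \<psi>: "\<forall>x. \<psi> x \<noteq> -\<infinity>" "convex_ereal \<psi>" "coercive \<psi>" "lsc \<psi>"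
    and meets: "M \<inter> edom \<psi> \<noteq> {}"
  shows
    "(\<bar>opt_value \<psi> M\<bar> \<noteq> \<infinity> \<and> (\<forall>lam>0. \<bar>opt_value (moreau lam \<psi>) (M_env lam)\<bar> \<noteq> \<infinity>) \<and>
      (seq_weakly_continuous h \<longrightarrow>
        ((\<lambda>lam. opt_value (moreau lam \<psi>) (M_env lam)) \<longlongrightarrow> opt_value \<psi> M) (at_right 0))) \<and>
     (\<forall>lams x x0.
        (\<forall>k. lams k > 0) \<and> lams \<longlonglongrightarrow> 0 \<and>
        (\<forall>k. optimal_solution (moreau (lams k) \<psi>) (M_env (lams k)) (x k)) \<and>
        weakly_tendsto x x0 \<and> seq_weakly_continuous h \<longrightarrow>
        optimal_solution \<psi> M x0 \<and>
        (edom \<psi> = UNIV \<and>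
         (\<forall>z\<in>dom_subdifferential (conjugate \<psi>). frechet_differentiable_at (conjugate \<psi>) z) \<longrightarrow>
         x \<longlonglongrightarrow> x0))"
proof -
  interpret prob_space \<Omega> by (rule \<xi>(1))
  have \<xi>_borel: "\<xi> \<in> borel_measurable \<Omega>"
    using \<xi>(2) distributed_measurable by fastforce
  define S where "S = sup_fun C \<Phi> h"
  have S_eq: "S = (\<lambda>q. SUP v\<in>C. ereal (blinfun_apply v (\<Phi> q) + h (fst q)))"
    unfolding S_def sup_fun_def by (simp add: case_prod_unfold)
  \<comment> \<open>An empty \<open>C\<close> would have an empty closed cone, but the dual cone
    contains 0. Nonemptiness keeps \<open>S\<close> away from \<open>-\<infinity>\<close>.\<close>
  have C_ne: "C \<noteq> {}"
  proof
    assume "C = {}"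
    then have "dual_cone K = {}"
      using C(3) by (simp add: cone_of_def)
    moreover have "0 \<in> dual_cone K"
      unfolding dual_cone_def by simp
    ultimately show False by blast
  qed
  have h_cont: "continuous_on UNIV h"
    using h(1) unfolding continuously_differentiable_def
    by (meson continuous_at_imp_continuous_on has_derivative_continuous)
  have S_ninf: "S q \<noteq> -\<infinity>" for q
  proof -
    obtain v where "v \<in> C" using C_ne by blast
    then have "ereal (blinfun_apply v (\<Phi> q) + h (fst q)) \<le> S q"
      unfolding S_eq by (intro SUP_upper)
    then show ?thesis by auto
  qed
  have S_convex: "convex_ereal S"
    unfolding S_eq using cvx by (intro convex_ereal_SUP) (simp add: case_prod_unfold)
  have S_lsc: "lsc S"
    unfolding S_eq
    by (intro lsc_SUP continuous_intros \<Phi> continuous_on_compose2[OF h_cont]) auto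
  have S_le: "S (x, z) \<le> ereal (h x) \<longleftrightarrow> \<Phi> (x, z) \<in> uminus ` K" for x z
    unfolding S_eq mem_uminus_cone_iff[OF K C(3)] by (simp add: SUP_le_iff)

  \<comment> \<open>Events, feasible sets and their weak limits\<close>
  define A where "A x = {\<omega> \<in> space \<Omega>. \<Phi> (x, \<xi> \<omega>) \<in> uminus ` K}" for x
  define A_env where "A_env lam x = {\<omega> \<in> space \<Omega>. moreau lam S (x, \<xi> \<omega>) \<le> ereal (h x)}" for lam x
  have mem_M: "x \<in> M \<longleftrightarrow> p \<le> measure \<Omega> (A x)" for x
    unfolding M_def feasible_def prob_fun_def A_def by simp
  have mem_M_env: "x \<in> M_env lam \<longleftrightarrow> p \<le> measure \<Omega> (A_env lam x)" for x lam
    unfolding M_env_def feasible_def prob_fun_env_def A_env_def S_def by simp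
  have A_env_sets: "A_env lam x \<in> sets \<Omega>" for lam x
    unfolding A_env_def by (rule sets_moreau_le[OF \<xi>_borel])
  have A_sets: "A x \<in> sets \<Omega>" for x
  proof -
    have "closed ((\<lambda>z. \<Phi> (x, z)) -` uminus ` K)"
      using K(4) by (intro closed_vimage closed_negations continuous_on_compose2[OF \<Phi>] continuous_intros) auto
    then have "\<xi> -` ((\<lambda>z. \<Phi> (x, z)) -` uminus ` K) \<inter> space \<Omega> \<in> sets \<Omega>"
      by (intro measurable_sets[OF \<xi>_borel] borel_closed)
    also have "\<xi> -` ((\<lambda>z. \<Phi> (x, z)) -` uminus ` K) \<inter> space \<Omega> = A x"
      unfolding A_def by auto
    finally show ?thesis .
  qed
  have M_sub: "M \<subseteq> M_env lam" for lam
  proof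
    fix x assume "x \<in> M"
    moreover have "A x \<subseteq> A_env lam x"
      unfolding A_def A_env_def using moreau_le[of lam S] S_le order_trans by blast
    then have "measure \<Omega> (A x) \<le> measure \<Omega> (A_env lam x)"
      by (rule finite_measure_mono[OF _ A_env_sets])
    ultimately show "x \<in> M_env lam"
      unfolding mem_M mem_M_env by simp
  qed
  \<comment> \<open>For an outcome outside \<open>A x0\<close>, a real \<open>r\<close> strictly
    between \<open>h x0\<close> and \<open>S (x0, \<xi> \<omega>)\<close> eventually separates
    \<open>h (x k)\<close> from the envelope. Such an outcome lies in only finitely many of the
    regularised events.\<close>
  have M_limit: "x0 \<in> M"
    if lams: "\<And>k. lams k > 0" "lams \<longlonglongrightarrow> 0" and x: "\<And>k. x k \<in> M_env (lams k)" "weakly_tendsto x x0"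
      and h_weak: "seq_weakly_continuous h" for lams x x0
    unfolding mem_M
  proof (rule measure_ge_limsup[OF A_env_sets _ A_sets])
    show "p \<le> measure \<Omega> (A_env (lams k) (x k))" for k
      using x(1) unfolding mem_M_env .
    fix \<omega> assume \<omega>: "\<omega> \<in> space \<Omega>" and freq: "\<exists>\<^sub>F k in sequentially. \<omega> \<in> A_env (lams k) (x k)"
    have "S (x0, \<xi> \<omega>) \<le> ereal (h x0)"
    proof (rule ccontr)
      assume "\<not> ?thesis"
      then have "ereal (h x0) < S (x0, \<xi> \<omega>)" by simp
      then obtain r where r: "h x0 < r" "ereal r < S (x0, \<xi> \<omega>)"
        using ereal_dense2 less_ereal.simps(1) by blast
      have "weakly_tendsto (\<lambda>k. (x k, \<xi> \<omega>)) (x0, \<xi> \<omega>)"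
        using x(2) unfolding weakly_tendsto_def by (auto intro!: tendsto_add)
      note moreau_weak_lsc[OF S_ninf S_convex S_lsc lams this r(2)]
      moreover have "\<forall>\<^sub>F k in sequentially. h (x k) < r"
        using h_weak x(2) r(1) order_tendstoD(2) unfolding seq_weakly_continuous_def by blast
      ultimately have "\<forall>\<^sub>F k in sequentially. \<omega> \<notin> A_env (lams k) (x k)"
      proof eventually_elim
        case (elim k)
        have "ereal (h (x k)) < ereal r" using elim(2) by simp
        also note elim(1)
        finally show ?case unfolding A_env_def by (simp add: not_le)
      qed
      then show False
        using freq unfolding frequently_def by simp
    qed
    then show "\<omega> \<in> A x0"
      unfolding A_def using \<omega> S_le by simp
  qed

  \<comment> \<open>Finiteness and convergence of the optimal values\<close>
  have \<psi>_ninf: "\<psi> x \<noteq> -\<infinity>" for x using \<psi>(1) by blast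
  obtain m where m: "\<And>x. ereal m \<le> \<psi> x"
    using coercive_bounded_below[OF \<psi>_ninf \<psi>(2,4,3)] by blast
  obtain a where a: "a \<in> M" "\<psi> a < \<infinity>"
    using meets unfolding edom_def by blast
  have value_le: "opt_value (moreau lam \<psi>) (M_env lam) \<le> opt_value \<psi> M" for lam
    unfolding opt_value_def using M_sub by (intro INF_mono) (auto intro: moreau_le)
  have value_upper: "opt_value \<psi> M < \<infinity>"
    using a unfolding opt_value_def INF_less_iff by blast
  have value_lower: "ereal m \<le> opt_value (moreau lam \<psi>) (M_env lam)" if "lam > 0" for lam
    unfolding opt_value_def moreau_def
  proof (intro INF_greatest)
    fix x w
    have "ereal m + 0 \<le> \<psi> w + ereal ((norm (x - w))\<^sup>2 / (2 * lam))"
      using m that by (intro add_mono) auto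
    then show "ereal m \<le> \<psi> w + ereal ((norm (x - w))\<^sup>2 / (2 * lam))" by simp
  qed
  have finite_value: "\<bar>opt_value \<psi> M\<bar> \<noteq> \<infinity>"
    using value_upper order_trans[OF value_lower[of 1] value_le[of 1]] by auto
  have finite_value_env: "\<bar>opt_value (moreau lam \<psi>) (M_env lam)\<bar> \<noteq> \<infinity>" if "lam > 0" for lam
    using value_lower[OF that] le_less_trans[OF value_le value_upper, of lam] by auto
  have limit: "((\<lambda>lam. opt_value (moreau lam \<psi>) (M_env lam)) \<longlongrightarrow> opt_value \<psi> M) (at_right 0)"
    if h_weak: "seq_weakly_continuous h"
  proof (rule order_tendstoI)
    fix b assume "opt_value \<psi> M < b"
    then show "\<forall>\<^sub>F lam in at_right 0. opt_value (moreau lam \<psi>) (M_env lam) < b"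
      using le_less_trans[OF value_le] by simp
  next
    fix b assume b: "b < opt_value \<psi> M"
    show "\<forall>\<^sub>F lam in at_right 0. b < opt_value (moreau lam \<psi>) (M_env lam)"
    proof (rule ccontr)
      assume not_ev: "\<not> ?thesis"
      \<comment> \<open>Failure of the eventual bound is turned into a sequence of parameters
        tending to 0 whose values stay at most \<open>b\<close>.\<close>
      have "\<exists>lam. 0 < lam \<and> lam < 1 / Suc k \<and> opt_value (moreau lam \<psi>) (M_env lam) \<le> b" for k
      proof (rule ccontr)
        assume "\<not> ?thesis"
        then have "\<forall>lam>0. lam < 1 / Suc k \<longrightarrow> b < opt_value (moreau lam \<psi>) (M_env lam)"
          by (auto simp: not_le)
        moreover have "(0::real) < 1 / Suc k" by simp
        ultimately show False
          using not_ev unfolding eventually_at_right_field by blast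
      qed
      then obtain lams where lams: "\<And>k. 0 < lams k" "\<And>k. lams k < 1 / Suc k"
        "\<And>k. opt_value (moreau (lams k) \<psi>) (M_env (lams k)) \<le> b"
        by metis
      have lams_lim: "lams \<longlonglongrightarrow> 0"
      proof (rule tendsto_sandwich[OF _ _ tendsto_const])
        show "(\<lambda>k. 1 / real (Suc k)) \<longlonglongrightarrow> 0"
          by (rule lim_1_over_n[THEN LIMSEQ_Suc])
      qed (use lams(1,2) in \<open>auto simp: less_imp_le\<close>)
      obtain c where c: "b < ereal c" "ereal c < opt_value \<psi> M"
        using ereal_dense2[OF b] by blast
      have "\<exists>y. y \<in> M_env (lams k) \<and> moreau (lams k) \<psi> y < ereal c" for k
        using le_less_trans[OF lams(3) c(1)] unfolding opt_value_def INF_less_iff by blast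
      then obtain x where x: "\<And>k. x k \<in> M_env (lams k)" "\<And>k. moreau (lams k) \<psi> (x k) < ereal c"
        by metis
      \<comment> \<open>Points \<open>w k\<close> witnessing the envelope bound lie in a sublevel
        set of \<open>\<psi>\<close>, bounded by coercivity; the penalty keeps \<open>x k\<close>
        near \<open>w k\<close>, so \<open>x\<close> is bounded as well.\<close>
      have "\<exists>w. \<psi> w + ereal ((norm (x k - w))\<^sup>2 / (2 * lams k)) < ereal c" for k
        using x(2)[of k] unfolding moreau_def INF_less_iff by blast
      then obtain w where w: "\<And>k. \<psi> (w k) + ereal ((norm (x k - w k))\<^sup>2 / (2 * lams k)) < ereal c"
        by metis
      obtain B where B: "\<And>u. \<psi> u \<le> ereal c \<Longrightarrow> norm u \<le> B"
        using \<psi>(3) unfolding coercive_def bounded_iff by blast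
      have "norm (x k) \<le> B + (2 * (c - m) + 1)" for k
      proof -
        obtain s where s: "\<psi> (w k) = ereal s"
          using w[of k] \<psi>_ninf[of "w k"] by (cases "\<psi> (w k)") auto
        have ws: "s + (norm (x k - w k))\<^sup>2 / (2 * lams k) < c" "m \<le> s"
          using w[of k] m[of "w k"] unfolding s by auto
        have pos: "0 \<le> (norm (x k - w k))\<^sup>2 / (2 * lams k)"
          using lams(1)[of k] by simp
        then have "norm (w k) \<le> B"
          using ws by (intro B) (simp add: s)
        moreover have "norm (x k - w k) \<le> 2 * (c - m) + 1"
        proof -
          have "1 / real (Suc k) \<le> 1" by simp
          then have "lams k < 1" using lams(2)[of k] by linarith
          have "(norm (x k - w k))\<^sup>2 / (2 * lams k) \<le> c - m"
            using ws by linarith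
          then have "(norm (x k - w k))\<^sup>2 \<le> 2 * lams k * (c - m)"
            using lams(1)[of k] by (simp add: pos_divide_le_eq mult.commute)
          also have "\<dots> \<le> 2 * 1 * (c - m)"
            using ws pos \<open>lams k < 1\<close> by (intro mult_right_mono) auto
          finally have "(norm (x k - w k))\<^sup>2 \<le> 2 * (c - m)" by simp
          \<comment> \<open>The inequality \<open>t \<le> t\<^sup>2 + 1\<close> trades the bound on
            the square for one on the norm without taking roots.\<close>
          moreover have "norm (x k - w k) \<le> (norm (x k - w k))\<^sup>2 + 1"
            using zero_le_power2[of "norm (x k - w k) - 1/2"] by (simp add: power2_eq_square algebra_simps)
          ultimately show ?thesis by linarith
        qed
        ultimately show ?thesis
          using norm_triangle_ineq[of "w k" "x k - w k"] by simp
      qed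
      then have "bounded (range x)"
        unfolding bounded_iff by blast
      then obtain x0 r where r: "strict_mono r" "weakly_tendsto (x \<circ> r) x0"
        using bounded_weakly_convergent_subsequence by blast
      have r_lim: "(lams \<circ> r) \<longlonglongrightarrow> 0"
        by (rule LIMSEQ_subseq_LIMSEQ[OF lams_lim r(1)])
      have "x0 \<in> M"
        by (rule M_limit[OF _ r_lim _ r(2) h_weak]) (use lams(1) x(1) in auto)
      then have "ereal c < \<psi> x0"
        using c(2) unfolding opt_value_def by (meson INF_lower less_le_trans)
      from moreau_weak_lsc[OF \<psi>_ninf \<psi>(2,4) _ r_lim r(2) this] lams(1)
      have "\<forall>\<^sub>F k in sequentially. ereal c < moreau ((lams \<circ> r) k) \<psi> ((x \<circ> r) k)"
        by simp
      then have "\<forall>\<^sub>F k in sequentially. False"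
      proof eventually_elim
        case (elim k)
        with x(2)[of "r k"] show False by simp
      qed
      then show False by simp
    qed
  qed

  \<comment> \<open>Optimality and strong convergence of weak limits\<close>
  have optimal: "optimal_solution \<psi> M x0 \<and>
      (edom \<psi> = UNIV \<and>
       (\<forall>z\<in>dom_subdifferential (conjugate \<psi>). frechet_differentiable_at (conjugate \<psi>) z) \<longrightarrow>
       x \<longlonglongrightarrow> x0)"
    if lams: "\<And>k. lams k > 0" "lams \<longlonglongrightarrow> 0"
      and opt: "\<And>k. optimal_solution (moreau (lams k) \<psi>) (M_env (lams k)) (x k)"
      and x: "weakly_tendsto x x0" and h_weak: "seq_weakly_continuous h" for lams x x0
  proof -
    have x_mem: "x k \<in> M_env (lams k)" for k
      using opt[of k] unfolding optimal_solution_def is_arg_min_def by blast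
    have x_le: "moreau (lams k) \<psi> (x k) \<le> \<psi> y" if "y \<in> M" for k y
    proof -
      have "moreau (lams k) \<psi> (x k) \<le> moreau (lams k) \<psi> y"
        using opt[of k] M_sub that unfolding optimal_solution_def is_arg_min_def
        by (meson not_less subsetD)
      also have "\<dots> \<le> \<psi> y" by (rule moreau_le)
      finally show ?thesis .
    qed
    have x0: "x0 \<in> M"
      by (rule M_limit[OF lams x_mem x h_weak])
    \<comment> \<open>By \<open>x_le\<close> no envelope value exceeds \<open>\<psi> y\<close>, so
      \<open>\<psi> y\<close> itself serves as the threshold in \<open>moreau_weak_lsc\<close> for a
      contradiction.\<close>
    have "\<not> \<psi> y < \<psi> x0" if y: "y \<in> M" for y
    proof
      assume "\<psi> y < \<psi> x0"
      from moreau_weak_lsc[OF \<psi>_ninf \<psi>(2,4) lams x this]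
      have "\<forall>\<^sub>F k in sequentially. False"
        by eventually_elim (use x_le[OF y] in \<open>simp add: not_less[symmetric]\<close>)
      then show False by simp
    qed
    then have "optimal_solution \<psi> M x0"
      using x0 unfolding optimal_solution_def is_arg_min_def by blast
    moreover have "x \<longlonglongrightarrow> x0"
      if dom: "edom \<psi> = UNIV"
        and diff: "\<forall>z\<in>dom_subdifferential (conjugate \<psi>). frechet_differentiable_at (conjugate \<psi>) z"
    proof -
      \<comment> \<open>Full domain and the exclusion of \<open>-\<infinity>\<close> make
        \<open>\<psi>\<close> real valued, as \<open>weak_imp_strong_convergence\<close> requires;
        its bound on the envelopes is \<open>x_le\<close> at \<open>x0\<close>.\<close>
      define F where "F u = real_of_ereal (\<psi> u)" for u
      have \<psi>_F: "\<psi> u = ereal (F u)" for u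
        using dom \<psi>_ninf[of u] unfolding F_def edom_def by (cases "\<psi> u") auto
      then have \<psi>_eq: "\<psi> = (\<lambda>u. ereal (F u))" by blast
      show ?thesis
        by (rule weak_imp_strong_convergence[of F, folded \<psi>_eq, OF \<psi>(2,4) _ lams x])
          (use diff x_le[OF x0] in \<open>auto simp flip: \<psi>_F\<close>)
    qed
    ultimately show ?thesis by blast
  qed
  show ?thesis
    using finite_value finite_value_env limit optimal by blast
qed

end
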